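(* For every integer $n\ge 1$, every $a = (a_1,\ldots,a_n) \in S^{n-1}$ (i.e. $\sum_{i=1}^n a_i^2 = 1$) and every real $p \ge 4$ we have $$\frac{\|S\|_p}{\|G\|_p} \le 1 - \frac16 \sum_{i=1}^n a_i^4,$$ where $S = \sum_{i=1}^n a_i \varepsilon_i$.
   Context: Here $\varepsilon_1,\ldots,\varepsilon_n$ are i.i.d. symmetric Bernoulli (Rademacher) random variables, i.e. $\mathbb{P}(\varepsilon_i = \pm 1) = \frac12$; $G \sim \mathcal{N}(0,1)$ is a standard Gaussian random variable; and $\|X\|_p = (\mathbb{E}|X|^p)^{1/p}$ for a real random variable $X$. *)

theory Defs
  imports "HOL-Probability.Probability"
begin

definition rademacher :: "'a measure \<Rightarrow> ('a \<Rightarrow> real) \<Rightarrow> bool" where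
  "rademacher M X \<longleftrightarrow>
     X \<in> borel_measurable M \<and>
     measure M {\<omega> \<in> space M. X \<omega> = 1} = 1/2 \<and>
     measure M {\<omega> \<in> space M. X \<omega> = -1} = 1/2"

definition standard_gaussian :: "'a measure \<Rightarrow> ('a \<Rightarrow> real) \<Rightarrow> bool" where
  "standard_gaussian M X \<longleftrightarrow> distributed M lborel X (\<lambda>x. ennreal (std_normal_density x))"

text \<open>The Bochner integral is 0 when \<open>\<bar>X\<bar> powr p\<close> is not integrable, so this is the usual
  norm only for random variables with a finite \<open>p\<close>-th absolute moment; bounded and Gaussian
  random variables have one for every \<open>p > 0\<close>.\<close>

definition Lp_norm :: "'a measure \<Rightarrow> real \<Rightarrow> ('a \<Rightarrow> real) \<Rightarrow> real" where
  "Lp_norm M p X = (\<integral>\<omega>. \<bar>X \<omega>\<bar> powr p \<partial>M) powr (1 / p)"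

end

theory Submission
  imports Defs
begin

text \<open>Write $S = \sum a_i\varepsilon_i$ with $\sum a_i^2 = 1$, put $x = \sum a_i^4$, and let $m_p = E|G|^p$. The
assertion is $E|S|^p \le (1 - x/6)^p m_p$, that is, $S$ is dominated in $p$-th moment by the Gaussian
$(1 - x/6)G$.

For $4 < p < 6$ this holds for a stronger reason. The function $|s|^p$ is a positive mixture of the functions
$r(ls)$ with $l > 0$, where $r(t) = 1 - t^2/2 + t^4/24 - \cos t$
(\<open>nn_integral_cos_remainder\<close>), and $E\,r(lS) \le E\,r(l(1 - x/6)G)$ for every single $l$
(\<open>sign_mean_cos_remainder_le\<close>). Both expectations are explicit: they involve
$E\cos(lS) = \prod\cos(la_i)$, the Gaussian $e^{-l^2/2}$, and moments up to order four. So the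
claim becomes a lower bound for a product of cosines, namely
$e^{-v} - \prod\cos(la_i) \le \frac{xv}{3}(1 - e^{-v}) + \frac{x^2v^3}{90}e^{-v}$ with $v = l^2/2$
(\<open>prod_cos_lower\<close>). Replacing the cosines by Gaussians one at a time reduces it to one-variable
inequalities; small and large angles need different treatment, since for large
angles a cosine is no longer smaller than the corresponding Gaussian. The first term on the right
is exactly what the tangent of the convex function $v \mapsto E\,r(lG)$ provides, and the second is absorbed
by the quadratic term that the tangent leaves over.

Larger exponents are reached in steps of two. Simpson's rule overestimates the integral of $|s|^p$ if
$p \ge 4$, which gives
$E|S|^{p+2} \le (p+1)\sum_i a_i^2\,(\frac13 E|S|^p + \frac23 E|S - a_i\varepsilon_i|^p)$
(\<open>sign_mean_powr_add_2\<close>). Since $m_{p+2} = (p+1)m_p$, the bound for $p$, applied also to the vectors with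
one deleted coordinate, yields the bound for $p + 2$ (\<open>khinchine_bound_add_2\<close>).

For $p = 4$ the fourth moment is $3 - 2x$ and Bernoulli's inequality suffices.\<close>

section \<open>Elementary inequalities for cosine and exponential\<close>
lemma cos_lower_Taylor4:
  fixes u :: real shows "1 - u\<^sup>2 / 2 + u^4 / 24 - u^6 / 720 \<le> cos u"
proof -
  obtain t where t: "cos u = (\<Sum>m<6. cos_coeff m * u ^ m) + cos (t + 1/2 * real 6 * pi) / fact 6 * u ^ 6"
    using Maclaurin_cos_expansion[of u 6] by blast
  have "- 1 * u^6 \<le> cos (t + 1/2 * real 6 * pi) * u ^ 6"
    by (rule mult_right_mono) auto
  moreover have "(\<Sum>m<6. cos_coeff m * u ^ m) = 1 - u\<^sup>2 / 2 + u^4 / 24"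
    by (simp add: cos_coeff_Suc sin_coeff_Suc eval_nat_numeral)
  ultimately show ?thesis using t by (simp add: fact_numeral)
qed

lemma cos_upper_Taylor4:
  fixes u :: real shows "cos u \<le> 1 - u\<^sup>2 / 2 + u^4 / 24"
proof -
  obtain t where t: "cos u = (\<Sum>m<4. cos_coeff m * u ^ m) + cos (t + 1/2 * real 4 * pi) / fact 4 * u ^ 4"
    using Maclaurin_cos_expansion[of u 4] by blast
  have "cos (t + 1/2 * real 4 * pi) * u ^ 4 \<le> 1 * u^4"
    by (rule mult_right_mono) auto
  moreover have "(\<Sum>m<4. cos_coeff m * u ^ m) = 1 - u\<^sup>2 / 2"
    by (simp add: cos_coeff_Suc sin_coeff_Suc eval_nat_numeral)
  ultimately show ?thesis using t by (simp add: fact_numeral)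
qed

lemma exp_lower_Taylor:
  fixes h :: real assumes "0 \<le> h" shows "(\<Sum>k<n. h ^ k / fact k) \<le> exp h"
proof -
  have "(\<Sum>k<n. h ^ k / fact k) \<le> (\<Sum>k. h ^ k / fact k)"
    by (rule sum_le_suminf) (use assms summable_exp[of h] in \<open>auto simp: field_simps\<close>)
  then show ?thesis by (simp add: exp_def divide_inverse mult.commute)
qed

lemma exp_lower_Taylor6:
  fixes h :: real assumes "0 \<le> h"
  shows "1 + h + h^2/2 + h^3/6 + h^4/24 + h^5/120 + h^6/720 \<le> exp h"
  using exp_lower_Taylor[OF assms, of 7] by (simp add: eval_nat_numeral algebra_simps)

lemma exp_neg_lower_Taylor3:
  fixes h :: real assumes "0 \<le> h"
  shows "1 - h + h^2/2 - h^3/6 \<le> exp (- h)"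
proof -
  have "\<exists>t. \<bar>t\<bar> \<le> \<bar>- h\<bar> \<and> exp (-h) = (\<Sum>m<4. (-h) ^ m / fact m) + (exp t / fact 4) * (-h) ^ 4"
    by (rule Maclaurin_exp_le)
  then obtain t where t: "exp (-h) = (\<Sum>m<4. (-h) ^ m / fact m) + (exp t / fact 4) * (-h) ^ 4"
    by blast
  have "0 \<le> (exp t / fact 4) * (-h) ^ 4" by simp
  with t show ?thesis by (simp add: eval_nat_numeral algebra_simps)
qed

text \<open>The bound $|\cos u| \le e^{-u^2/2}$ holds somewhat beyond the first zero $u^2 = \pi^2/4 \approx 2.47$
of the cosine and fails before $u^2 = 3.3$. The cut-off $27/10$ used from here on lies in the window in
which this bound is still true and the estimate of \<open>cos_exp_large\<close> below has become true.\<close>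
lemma abs_cos_le_exp:
  fixes u :: real assumes "u\<^sup>2 \<le> 27/10" shows "\<bar>cos u\<bar> \<le> exp (- (u\<^sup>2 / 2))"
proof -
  define w where "w = u\<^sup>2"
  have w: "0 \<le> w" "w \<le> 27/10" using assms by (auto simp: w_def)
  have e: "1 - w/2 + w^2/8 - w^3/48 \<le> exp (- (w/2))"
    using exp_neg_lower_Taylor3[of "w/2"] w by (simp add: power_divide)
  have c1: "cos u \<le> 1 - w/2 + w^2/24" and c2: "1 - w/2 + w^2/24 - w^3/720 \<le> cos u"
    using cos_upper_Taylor4[of u] cos_lower_Taylor4[of u] by (simp_all add: w_def flip: power_mult)
  have "0 \<le> w^2 * (4 - w)" using w by (intro mult_nonneg_nonneg) auto
  then have "w^3 \<le> 4 * w^2" by (simp add: algebra_simps eval_nat_numeral)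
  then have "cos u \<le> exp (- (w/2))" using e c1 by linarith
  moreover have "- cos u \<le> exp (- (w/2))"
  proof -
    define v where "v = 27/10 - w"
    have v: "0 \<le> v" using w by (simp add: v_def)
    have weq: "w = 27/10 - v" by (simp add: v_def)
    have *: "(1 - w/2 + w^2/8 - w^3/48) + (1 - w/2 + w^2/24 - w^3/720)
       = 97/1250 + v * (293/500 - v/75) + v^3/45"
      unfolding weq by (simp add: field_simps eval_nat_numeral)
    have "0 \<le> v * (293/500 - v/75)"
      using v w by (intro mult_nonneg_nonneg) (auto simp: v_def)
    moreover have "0 \<le> v^3" using v by simp
    ultimately have "0 \<le> (1 - w/2 + w^2/8 - w^3/48) + (1 - w/2 + w^2/24 - w^3/720)"
      unfolding * by linarith
    then show ?thesis using e c2 by linarith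
  qed
  ultimately show ?thesis by (simp add: w_def)
qed

text \<open>The power series of both sides agree up to and including order six. The summand $u^6/720$ is there because
$e^{-u^2/2} - \cos u \le \frac{u^2}{6}(1 - e^{-u^2/2})$, the inequality that one would like to have, is
off by exactly $u^6/720$ in the sixth order; the price is paid back by convexity in
\<open>sign_mean_cos_remainder_le\<close>.\<close>
lemma cos_exp_small:
  fixes u :: real assumes "u\<^sup>2 \<le> 27/10"
  shows "1 - cos u * exp (u\<^sup>2/2) \<le> u\<^sup>2/6 * (exp (u\<^sup>2/2) - 1) + u^6/720"
proof -
  define w where "w = u\<^sup>2"
  have w: "0 \<le> w" "w \<le> 27/10" using assms by (auto simp: w_def)
  \<comment> \<open>The Taylor polynomials of \<open>exp (w / 2)\<close> and of \<open>cos u + w / 6\<close> with denominators cleared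
     (\<open>46080 = 2 ^ 6 * 6!\<close> and \<open>720 = 6!\<close>); \<open>C * T\<close> and
     \<open>720 * 46080 * (1 + w / 6 - w ^ 3 / 720)\<close> differ from order \<open>w ^ 4\<close> on only.\<close>
  define T where "T = 46080 + 23040*w + 5760*w^2 + 960*w^3 + 120*w^4 + 12*w^5 + w^6"
  define C where "C = 720 - 240*w + 30*w^2 - w^3"
  have T: "T / 46080 \<le> exp (w/2)"
    using exp_lower_Taylor6[of "w/2"] w by (simp add: power_divide T_def add_divide_distrib)
  have C: "C / 720 \<le> cos u + w/6"
    using cos_lower_Taylor4[of u]
    by (simp add: w_def C_def add_divide_distrib diff_divide_distrib flip: power_mult)
  have "0 \<le> w^2 * (30 - w)" using w by (intro mult_nonneg_nonneg) auto
  then have "0 \<le> 30 * w^2 - w^3" by (simp add: algebra_simps eval_nat_numeral)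
  then have pos: "0 \<le> C / 720" using w by (simp add: C_def)
  have "0 \<le> w^4 * (18 - w)" using w by (intro mult_nonneg_nonneg) auto
  moreover have "0 \<le> w^2" by simp
  ultimately have "0 \<le> w^4 * (5760 + 2880*w + 480*w^2 + w^4 * (18 - w))"
    using w by (intro mult_nonneg_nonneg add_nonneg_nonneg) auto
  also have "\<dots> = C * T - (33177600 + 5529600*w - 46080*w^3)"
    unfolding C_def T_def by algebra
  finally have "1 + w/6 - w^3/720 \<le> (C/720) * (T/46080)" by simp
  also have "\<dots> \<le> (cos u + w/6) * exp (w/2)"
    using C T pos by (intro mult_mono) (use w in \<open>auto simp: T_def\<close>)
  finally show ?thesis by (simp add: w_def algebra_simps flip: power_mult)
qed

text \<open>Away from the origin the inequality needs no correction, and it even holds with an absolute value,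
which the induction in \<open>prod_cos_large\<close> requires.\<close>
lemma cos_exp_large:
  fixes u :: real assumes "27/10 \<le> u\<^sup>2"
  shows "\<bar>exp (- (u\<^sup>2/2)) - cos u\<bar> \<le> u\<^sup>2/6 * (1 - exp (- (u\<^sup>2/2)))"
proof -
  define w where "w = u\<^sup>2"
  have w: "27/10 \<le> w" using assms by (auto simp: w_def)
  have e1: "exp (-(w/2)) \<le> 1" "0 < exp (-(w/2))" using w by auto
  have "cos u - exp (- (w/2)) \<le> w/6 * (1 - exp (- (w/2)))"
  proof (cases "w \<ge> 6")
    case True
    have "cos u - exp (- (w/2)) \<le> 1 * (1 - exp (-(w/2)))" by simp
    also have "\<dots> \<le> w/6 * (1 - exp (-(w/2)))" using True e1 by (intro mult_right_mono) auto
    finally show ?thesis .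
  next
    case False
    have "0 \<le> (w - 27/10) * (6 - w)" using w False by (intro mult_nonneg_nonneg) auto
    then have "w^2 \<le> 87/10 * w - 162/10" by (simp add: field_simps power2_eq_square)
    moreover have "cos u \<le> 1 - w/2 + w^2/24"
      using cos_upper_Taylor4[of u] by (simp add: w_def flip: power_mult)
    ultimately have "cos u \<le> 1/10" using w by linarith
    moreover have "c - e \<le> 9/20 * (1 - e)" if "c \<le> 1/10" "0 < e" for c e :: real
      using that by (simp add: field_simps)
    ultimately have "cos u - exp (-(w/2)) \<le> 9/20 * (1 - exp(-(w/2)))" using e1 by blast
    also have "\<dots> \<le> w/6 * (1 - exp (- (w/2)))"
      using w e1 by (intro mult_right_mono) auto
    finally show ?thesis .
  qed
  moreover have "exp (- (w/2)) - cos u \<le> w/6 * (1 - exp (- (w/2)))"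
    \<comment> \<open>From \<open>15/2\<close> on the trivial bound \<open>- 1 \<le> cos u\<close> is enough; before, the Taylor polynomials of
       \<open>cos_exp_small\<close> are accurate enough.\<close>
  proof (cases "w \<ge> 15/2")
    case True
    have "exp (w/2) \<ge> 1 + w/2 + (w/2)^2/2"
      using exp_lower_Taylor_quadratic[of "w/2"] True by simp
    moreover have "(w/2)^2 \<ge> (15/4)^2" using True by (intro power_mono) auto
    ultimately have "9 \<le> exp (w/2)" using True by (simp add: power2_eq_square)
    then have "(w/6 - 1) * 9 \<le> (w/6 - 1) * exp (w/2)"
      using True by (intro mult_left_mono) auto
    then have "1 + w/6 \<le> (w/6 - 1) * exp (w/2)" using True by simp
    then have "exp (-(w/2)) * (1 + w/6) \<le> w/6 - 1"
      by (simp add: exp_minus field_simps)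
    moreover define c where "c = cos u"
    then have "-1 \<le> c" by simp
    ultimately show ?thesis unfolding c_def[symmetric] by (simp add: algebra_simps)
  next
    case False
    define T where "T = 46080 + 23040*w + 5760*w^2 + 960*w^3 + 120*w^4 + 12*w^5 + w^6"
    define C where "C = 720 - 240*w + 30*w^2 - w^3"
    have T: "T / 46080 \<le> exp (w/2)"
      using exp_lower_Taylor6[of "w/2"] w by (simp add: power_divide T_def add_divide_distrib)
    have Tpos: "0 < T" using w by (auto simp: T_def intro!: add_pos_nonneg)
    have C: "C / 720 \<le> cos u + w/6"
      using cos_lower_Taylor4[of u]
      by (simp add: w_def C_def add_divide_distrib diff_divide_distrib flip: power_mult)
    have pw: "(27/10)^2 \<le> w^2" "(27/10)^3 \<le> w^3" "(27/10)^5 \<le> w^5"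
      using w by (intro power_mono; simp)+
    then have "(27/10)^5 * 10 \<le> w^5 * (18 - w)"
      using w False by (intro mult_mono) auto
    with pw w have "0 \<le> - 46080 + 5760 * w + 2880 * w^2 + 480 * w^3 + w^5 * (18 - w)"
      by (simp add: power_divide)
    then have "0 \<le> w^3 * (- 46080 + 5760 * w + 2880 * w^2 + 480 * w^3 + w^5 * (18 - w))"
      using w by (intro mult_nonneg_nonneg) auto
    also have "\<dots> = C * T - (33177600 + 5529600*w)"
      unfolding C_def T_def by algebra
    finally have "1 + w/6 \<le> (C/720) * (T/46080)" by simp
    also have "\<dots> \<le> (cos u + w/6) * (T/46080)"
      using C Tpos by (intro mult_right_mono) auto
    finally have *: "1 + w/6 \<le> (cos u + w/6) * (T/46080)" .
    then have "0 < (cos u + w/6) * (T/46080)" using w by linarith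
    then have "cos u + w/6 > 0" using Tpos by (simp add: zero_less_mult_iff)
    then have "1 + w/6 \<le> (cos u + w/6) * exp (w/2)"
      using * mult_left_mono[OF T, of "cos u + w/6"] by linarith
    then have "exp (-(w/2)) * (1 + w/6) \<le> cos u + w/6"
      by (simp add: exp_minus field_simps)
    then show ?thesis by (simp add: algebra_simps)
  qed
  ultimately show ?thesis by (intro abs_leI) (simp_all add: w_def)
qed

section \<open>Products of cosines compared with a Gaussian\<close>
lemma half_square_le:
  fixes h :: real assumes "0 \<le> h"
  shows "h\<^sup>2 / 2 \<le> 1 - exp h + h * exp h"
proof -
  let ?f = "\<lambda>h::real. 1 - exp h + h * exp h - h\<^sup>2 / 2"
  have "?f 0 \<le> ?f h"
  proof (rule DERIV_nonneg_imp_nondecreasing[OF assms])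
    fix x :: real assume "0 \<le> x" "x \<le> h"
    then have "0 \<le> x * exp x - x" using mult_left_mono[of 1 "exp x" x] by simp
    moreover have "(?f has_real_derivative x * exp x - x) (at x)"
      by (auto intro!: derivative_eq_intros)
    ultimately show "\<exists>y. (?f has_real_derivative y) (at x) \<and> 0 \<le> y" by blast
  qed
  then show ?thesis by simp
qed

lemma exp_mult_diff_ge:
  fixes h k :: real assumes "0 \<le> h" "1 \<le> k"
  shows "(k - 1) * h\<^sup>2 / 2 \<le> (exp (k * h) - 1) - k * (exp h - 1)"
proof -
  have "exp (k * h) = exp h * exp ((k-1) * h)" by (simp add: algebra_simps flip: exp_add)
  also have "\<dots> \<ge> exp h * (1 + (k-1) * h)" by simp
  finally have "exp (k*h) - k * exp h + (k - 1) \<ge> (k - 1) * (1 - exp h + h * exp h)"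
    by (simp add: algebra_simps)
  moreover have "(k - 1) * (1 - exp h + h * exp h) \<ge> (k - 1) * (h\<^sup>2 / 2)"
    using half_square_le[OF assms(1)] assms by (intro mult_left_mono) auto
  ultimately show ?thesis by (simp add: algebra_simps)
qed

text \<open>The same estimate with the right-hand side expressed through the total $V$ of all squares instead of
the single square $u^2$. With $s = u^2/V \le 1$ the right-hand side of \<open>cos_exp_small\<close> is the
case $s = 1$ of $\frac{s w}{6}(e^{w/(2s)} - 1) + \frac{s w^3}{720}$, and the growth of
$s \mapsto s(e^{w/(2s)} - 1)$ as $s$ decreases outweighs the loss in the last term.\<close>
lemma cos_exp_small_scaled:
  fixes u V :: real assumes "u\<^sup>2 \<le> 27/10" "u\<^sup>2 \<le> V"
  shows "1 - cos u * exp (u\<^sup>2/2) \<le> u^4 / (6*V) * (exp (V/2) - 1) + u^8 / (720 * V)"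
proof (cases "u = 0")
  case False
  define w where "w = u\<^sup>2"
  define k where "k = V / w"
  have w: "0 < w" "w \<le> V" using assms False by (auto simp: w_def)
  then have k: "1 \<le> k" and V: "V = k * w" "0 < V" by (auto simp: k_def)
  have "(w/6) * (exp (w/2) - 1) + w^3/720 \<le> w^2 / (6*V) * (exp (V/2) - 1) + w^4 / (720 * V)"
  proof -
    have "(k - 1) * (w/2)\<^sup>2 / 2 \<le> (exp (k * (w/2)) - 1) - k * (exp (w/2) - 1)"
      using exp_mult_diff_ge[of "w/2" k] w k by simp
    moreover have "(k - 1) * (w\<^sup>2 / 120) \<le> (k - 1) * ((w/2)\<^sup>2 / 2)"
      using w k by (intro mult_left_mono) (auto simp: power_divide)
    ultimately have "k * (exp (w/2) - 1) + (k - 1) * w\<^sup>2 / 120 \<le> exp (V/2) - 1"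
      by (simp add: V)
    then have "w / (6 * k) * (k * (exp (w/2) - 1) + (k - 1) * w\<^sup>2 / 120) \<le> w / (6 * k) * (exp (V/2) - 1)"
      using w k by (intro mult_left_mono) auto
    moreover have "w / (6 * k) * (k * (exp (w/2) - 1) + (k - 1) * w\<^sup>2 / 120)
       = (w/6) * (exp (w/2) - 1) + w^3/720 - w^4 / (720 * V)"
      using w k by (simp add: V field_simps eval_nat_numeral)
    moreover have "w / (6 * k) = w^2 / (6 * V)" using w k by (simp add: V power2_eq_square)
    ultimately show ?thesis by simp
  qed
  then show ?thesis using cos_exp_small[OF assms(1)] by (simp add: w_def flip: power_mult)
qed simp

text \<open>The absolute derivative $e^{-L}$ of the convex function $e^{-x}$ at the common end point separates
the absolute slopes of its chords over $[L,L+w]$ and $[0,L]$.\<close>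
lemma exp_diff_quot_le:
  fixes L w :: real assumes "0 < L" "0 < w"
  shows "(exp (-L) - exp (-(L+w))) / w \<le> (1 - exp (-L)) / L"
proof -
  have "(exp (-L) - exp (-(L+w))) = exp (-L) * (1 - exp (-w))" by (simp add: right_diff_distrib flip: exp_add)
  also have "\<dots> \<le> exp (-L) * w" using exp_ge_add_one_self[of "-w"] by simp
  finally have 1: "(exp (-L) - exp (-(L+w))) / w \<le> exp (-L)" using assms by (simp add: field_simps)
  have "L * exp (-L) \<le> 1 - exp (-L)"
    using exp_ge_add_one_self[of L] by (simp add: exp_minus field_simps)
  then have "exp (-L) \<le> (1 - exp (-L)) / L" using assms by (simp add: field_simps)
  with 1 show ?thesis by simp
qed

text \<open>Factors are added in increasing order of $u_i^2$. Replacing the last cosine by $e^{-u_j^2/2}$ costs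
$\frac{u_j^2}{6}(E - F)$, where $E$ and $F$ are the Gaussian factors before and after, and the
earlier error is at most $\frac{Q}{6W}(1 - E)$ by induction. The sum is
dominated by the claim because it pairs the larger weight $u_j^2 \ge Q/W$ with the flatter
chord of $e^{-x}$ (Chebyshev's sum inequality). Since the sign of $\cos u_j$ is unknown, the
induction has to control the absolute value of the error.\<close>
lemma prod_cos_large:
  fixes u :: "'i \<Rightarrow> real"
  assumes "finite A" "\<And>i. i \<in> A \<Longrightarrow> 27/10 \<le> (u i)\<^sup>2"
  shows "\<bar>exp (- ((\<Sum>i\<in>A. (u i)\<^sup>2) / 2)) - (\<Prod>i\<in>A. cos (u i))\<bar>
    \<le> (\<Sum>i\<in>A. (u i)^4) / (6 * (\<Sum>i\<in>A. (u i)\<^sup>2)) * (1 - exp (- ((\<Sum>i\<in>A. (u i)\<^sup>2) / 2)))"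
  using assms
proof (induction A rule: finite_ranking_induct[where f = "\<lambda>i. (u i)\<^sup>2"])
  case empty
  then show ?case by simp
next
  case (insert j A)
  show ?case
  proof (cases "j \<in> A \<or> A = {}")
    case True
    then show ?thesis
    proof
      assume "j \<in> A" then show ?thesis using insert by (simp add: insert_absorb)
    next
      assume "A = {}"
      then show ?thesis using cos_exp_large[of "u j"] insert.prems[of j]
        by (simp add: power2_eq_square eval_nat_numeral)
    qed
  next
    case False
    define W where "W = (\<Sum>i\<in>A. (u i)\<^sup>2)"
    define Q where "Q = (\<Sum>i\<in>A. (u i)^4)"
    define w where "w = (u j)\<^sup>2"
    define P where "P = (\<Prod>i\<in>A. cos (u i))"
    define E where "E = exp (- (W/2))"
    define R where "R = (Q + w\<^sup>2) / (6 * (W + w)) * (1 - exp (- ((W + w)/2)))"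
    define F where "F = exp (- ((W + w)/2))"
    have w: "27/10 \<le> w" using insert.prems by (auto simp: w_def)
    have W: "W > 0"
    proof -
      have "(u i)\<^sup>2 > 0" if "i \<in> A" for i using insert.prems[of i] that by auto
      then show ?thesis unfolding W_def using False insert.hyps by (intro sum_pos) auto
    qed
    have QW: "Q \<le> w * W"
    proof -
      have "Q \<le> (\<Sum>i\<in>A. w * (u i)\<^sup>2)" unfolding Q_def
      proof (rule sum_mono)
        fix i assume "i \<in> A"
        have "(u i)^4 = (u i)\<^sup>2 * (u i)\<^sup>2" by (simp flip: power_add)
        also have "\<dots> \<le> w * (u i)\<^sup>2" using insert.hyps(2)[OF \<open>i \<in> A\<close>] by (intro mult_right_mono) (auto simp: w_def)
        finally show "(u i)^4 \<le> w * (u i)\<^sup>2" .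
      qed
      then show ?thesis by (simp add: W_def sum_distrib_left)
    qed
    have IH: "\<bar>E - P\<bar> \<le> Q / (6 * W) * (1 - E)"
      using insert.IH insert.prems by (simp add: W_def Q_def P_def E_def)
    have F: "F = E * exp (-(w/2))" by (simp add: E_def F_def add_divide_distrib flip: exp_add)
    have step: "\<bar>E * (exp (-(w/2)) - cos (u j))\<bar> \<le> w/6 * (E - F)"
    proof -
      have "\<bar>E * (exp (-(w/2)) - cos (u j))\<bar> = E * \<bar>exp (-(w/2)) - cos (u j)\<bar>" by (simp add: abs_mult E_def)
      also have "\<dots> \<le> E * (w/6 * (1 - exp (-(w/2))))"
        using cos_exp_large[of "u j"] w by (intro mult_left_mono) (auto simp: w_def E_def)
      finally show ?thesis by (simp add: F algebra_simps)
    qed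
    have "F - cos (u j) * P = E * (exp (-(w/2)) - cos (u j)) + cos (u j) * (E - P)"
      by (simp add: F algebra_simps)
    then have "\<bar>F - cos (u j) * P\<bar> \<le> w/6 * (E - F) + \<bar>cos (u j)\<bar> * \<bar>E - P\<bar>"
      using step abs_triangle_ineq[of "E * (exp (-(w/2)) - cos (u j))" "cos (u j) * (E - P)"]
      by (simp add: abs_mult)
    also have "\<bar>cos (u j)\<bar> * \<bar>E - P\<bar> \<le> 1 * (Q / (6 * W) * (1 - E))"
      using IH by (intro mult_mono) auto
    finally have A: "\<bar>F - cos (u j) * P\<bar> \<le> w/6 * (E - F) + Q / (6 * W) * (1 - E)" by simp
    have "(E - F) / (w/2) \<le> (1 - E) / (W/2)"
      using exp_diff_quot_le[of "W/2" "w/2"] W w unfolding E_def F_def add_divide_distrib by simp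
    moreover have "x / (c/2) = 2 * (x/c)" for x c :: real by simp
    ultimately have "(E - F) / w \<le> (1 - E) / W" by (simp only: mult_le_cancel_left_pos zero_less_numeral)
    then have "0 \<le> w * (w * W - Q) / (W + w) * ((1 - E) / W - (E - F) / w)"
      using QW W w by (intro mult_nonneg_nonneg divide_nonneg_nonneg) auto
    also have "\<dots> = 6 * (R - (w/6 * (E - F) + Q / (6 * W) * (1 - E)))"
      unfolding R_def F_def[symmetric] using W w by (simp add: divide_simps) (simp add: algebra_simps power2_eq_square)
    finally have "0 \<le> 6 * (R - (w/6 * (E - F) + Q / (6 * W) * (1 - E)))" .
    moreover have "a \<le> b" if "0 \<le> 6 * (b - a)" for a b :: real using that by simp
    ultimately have "w/6 * (E - F) + Q / (6 * W) * (1 - E) \<le> R" by blast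
    with A have "\<bar>F - cos (u j) * P\<bar> \<le> R" by (rule order_trans)
    then show ?thesis using False insert.hyps(1)
      by (simp add: R_def W_def Q_def w_def F_def P_def add.commute flip: power_mult)
  qed
qed

lemma exp_quot_mono:
  fixes x y :: real assumes "0 < x" "x \<le> y"
  shows "(exp x - 1) / x \<le> (exp y - 1) / y"
proof -
  have "0 \<le> (y/x - 1) * x\<^sup>2 / 2" using assms by simp
  also have "\<dots> \<le> (exp (y/x * x) - 1) - y/x * (exp x - 1)"
    using assms by (intro exp_mult_diff_ge) auto
  finally have "0 \<le> (exp (y/x * x) - 1) - y/x * (exp x - 1)" .
  then show ?thesis using assms by (simp add: field_simps)
qed

text \<open>The comparison of $\prod_i \cos u_i$ with $e^{-V/2}$, multiplied by $e^{V/2}$. Indices with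
$u_i^2 \ge 27/10$ are handled together by \<open>prod_cos_large\<close>. For the others
$y_i = e^{u_i^2/2}\cos u_i$ lies in $[-1,1]$, so that $1 - \prod y_i$ is at most the sum
of the $1 - y_i$, each of which is bounded by \<open>cos_exp_small_scaled\<close>. All bounds are proportional to
$u_i^4$, apart from the sixth-order correction, which sums to at most $Q^2/(720V)$.\<close>
lemma prod_cos_lower:
  fixes u :: "'i \<Rightarrow> real"
  assumes "finite I"
  defines "V \<equiv> \<Sum>i\<in>I. (u i)\<^sup>2" and "Q \<equiv> \<Sum>i\<in>I. (u i)^4"
  assumes "V > 0"
  shows "1 - exp (V/2) * (\<Prod>i\<in>I. cos (u i)) \<le> Q / (6*V) * (exp (V/2) - 1) + Q\<^sup>2 / (720 * V)"
proof -
  define A where "A = {i\<in>I. 27/10 \<le> (u i)\<^sup>2}"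
  define B where "B = {i\<in>I. \<not> 27/10 \<le> (u i)\<^sup>2}"
  have AB: "I = A \<union> B" "A \<inter> B = {}" "finite A" "finite B" using assms(1) by (auto simp: A_def B_def)
  define y where "y i = cos (u i) * exp ((u i)\<^sup>2 / 2)" for i
  define VA where "VA = (\<Sum>i\<in>A. (u i)\<^sup>2)"
  define QA where "QA = (\<Sum>i\<in>A. (u i)^4)"
  have prod_y: "(\<Prod>i\<in>S. y i) = exp ((\<Sum>i\<in>S. (u i)\<^sup>2)/2) * (\<Prod>i\<in>S. cos (u i))" if "finite S" for S
    using that by (simp add: y_def prod.distrib exp_sum sum_divide_distrib mult.commute)
  have uV: "(u i)\<^sup>2 \<le> V" if "i \<in> I" for i
    unfolding V_def using that assms(1) by (intro member_le_sum) auto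
  have yB: "\<bar>y i\<bar> \<le> 1" if "i \<in> B" for i
  proof -
    have "\<bar>y i\<bar> = \<bar>cos (u i)\<bar> * exp ((u i)\<^sup>2/2)" by (simp add: y_def abs_mult)
    also have "\<dots> \<le> exp (-((u i)\<^sup>2/2)) * exp ((u i)\<^sup>2/2)"
      using abs_cos_le_exp[of "u i"] that by (intro mult_right_mono) (auto simp: B_def)
    finally show ?thesis by (simp flip: exp_add)
  qed
  have zB: "\<bar>1 - y i\<bar> \<le> (u i)^4 / (6*V) * (exp (V/2) - 1) + (u i)^8 / (720 * V)" if "i \<in> B" for i
    using cos_exp_small_scaled[of "u i" V] uV[of i] yB[OF that] that by (auto simp: y_def B_def)
  have "\<bar>(\<Prod>i\<in>B. 1) - (\<Prod>i\<in>B. y i)\<bar> \<le> (\<Sum>i\<in>B. \<bar>1 - y i\<bar>)"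
    using norm_prod_diff[of B "\<lambda>_. 1" y] yB by simp
  also have "\<dots> \<le> (\<Sum>i\<in>B. (u i)^4 / (6*V) * (exp (V/2) - 1) + (u i)^8 / (720 * V))"
    by (intro sum_mono zB)
  finally have B1: "\<bar>1 - (\<Prod>i\<in>B. y i)\<bar> \<le> (\<Sum>i\<in>B. (u i)^4) / (6*V) * (exp (V/2) - 1) + (\<Sum>i\<in>B. (u i)^8) / (720 * V)"
    by (simp add: sum.distrib sum_divide_distrib sum_distrib_right)
  have A1: "\<bar>1 - (\<Prod>i\<in>A. y i)\<bar> \<le> QA / (6*V) * (exp (V/2) - 1)"
  proof (cases "A = {}")
    case False
    have "VA > 0" unfolding VA_def using False AB(3) by (intro sum_pos) (auto simp: A_def)
    have "VA \<le> V" unfolding VA_def V_def using AB(1) assms(1) by (intro sum_mono2) auto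
    have "1 - (\<Prod>i\<in>A. y i) = exp (VA/2) * (exp (-(VA/2)) - (\<Prod>i\<in>A. cos (u i)))"
      using AB(3) by (simp add: prod_y[of A] VA_def right_diff_distrib flip: exp_add)
    then have "\<bar>1 - (\<Prod>i\<in>A. y i)\<bar> = exp (VA/2) * \<bar>exp (-(VA/2)) - (\<Prod>i\<in>A. cos (u i))\<bar>"
      by (simp add: abs_mult)
    also have "\<dots> \<le> exp (VA/2) * (QA / (6 * VA) * (1 - exp (- (VA/2))))"
      using prod_cos_large[of A u] AB(3) by (intro mult_left_mono) (auto simp: A_def VA_def QA_def)
    also have "\<dots> = QA / 12 * ((exp (VA/2) - 1) / (VA/2))"
      by (simp add: right_diff_distrib exp_minus divide_simps)
    also have "\<dots> \<le> QA / 12 * ((exp (V/2) - 1) / (V/2))"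
      using \<open>VA > 0\<close> \<open>VA \<le> V\<close> by (intro mult_left_mono exp_quot_mono) (auto simp: QA_def intro!: sum_nonneg)
    also have "QA / 12 * (r / (V/2)) = QA / (6*V) * r" for r by simp
    finally show ?thesis .
  qed (simp add: QA_def)
  have split: "(\<Prod>i\<in>I. y i) = (\<Prod>i\<in>A. y i) * (\<Prod>i\<in>B. y i)"
    "Q = QA + (\<Sum>i\<in>B. (u i)^4)"
    unfolding Q_def QA_def AB(1) using AB(2-4) by (simp_all add: prod.union_disjoint sum.union_disjoint)
  have "(\<Prod>i\<in>B. y i) * (1 - (\<Prod>i\<in>A. y i)) \<le> \<bar>\<Prod>i\<in>B. y i\<bar> * \<bar>1 - (\<Prod>i\<in>A. y i)\<bar>"
    by (metis abs_ge_self abs_mult)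
  also have "\<dots> \<le> 1 * \<bar>1 - (\<Prod>i\<in>A. y i)\<bar>"
    using yB by (intro mult_right_mono) (auto simp: abs_prod intro!: prod_le_1)
  finally have AB': "(\<Prod>i\<in>B. y i) * (1 - (\<Prod>i\<in>A. y i)) \<le> \<bar>1 - (\<Prod>i\<in>A. y i)\<bar>" by simp
  have "(\<Sum>i\<in>B. (u i)^8) \<le> (\<Sum>i\<in>I. (u i)^4 * (u i)^4)"
    using assms(1) AB(1) by (subst power_add[symmetric]) (auto intro!: sum_mono2)
  also have "\<dots> \<le> (\<Sum>i\<in>I. (u i)^4 * Q)"
    using assms(1) by (intro sum_mono mult_left_mono) (auto simp: Q_def intro!: member_le_sum)
  finally have "(\<Sum>i\<in>B. (u i)^8) \<le> Q\<^sup>2" by (simp add: sum_distrib_right Q_def power2_eq_square)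
  then have Q8: "(\<Sum>i\<in>B. (u i)^8) / (720 * V) \<le> Q\<^sup>2 / (720 * V)"
    using \<open>V > 0\<close> by (intro divide_right_mono) auto
  have "1 - (\<Prod>i\<in>I. y i) = (1 - (\<Prod>i\<in>B. y i)) + (\<Prod>i\<in>B. y i) * (1 - (\<Prod>i\<in>A. y i))"
    unfolding split by (simp add: algebra_simps)
  also have "\<dots> \<le> \<bar>1 - (\<Prod>i\<in>B. y i)\<bar> + \<bar>1 - (\<Prod>i\<in>A. y i)\<bar>"
    using AB' by (intro add_mono) auto
  also have "\<dots> \<le> ((\<Sum>i\<in>B. (u i)^4) / (6*V) * (exp (V/2) - 1) + Q\<^sup>2 / (720 * V))
      + QA / (6*V) * (exp (V/2) - 1)"
    using A1 B1 Q8 by (intro add_mono) auto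
  also have "\<dots> = Q / (6*V) * (exp (V/2) - 1) + Q\<^sup>2 / (720 * V)"
    unfolding split by (simp add: add_divide_distrib algebra_simps)
  finally show ?thesis using prod_y[of I] assms(1) by (simp add: V_def)
qed

section \<open>Averages over choices of signs\<close>

text \<open>The expectation of $f(\sum_{i \in I} a_i \varepsilon_i)$ as a finite sum; $J$ is the set of indices with
$\varepsilon_i = 1$.\<close>
definition sign_mean :: "'i set \<Rightarrow> ('i \<Rightarrow> real) \<Rightarrow> (real \<Rightarrow> real) \<Rightarrow> real" where
  "sign_mean I a f = (\<Sum>J\<in>Pow I. f ((\<Sum>i\<in>J. a i) - (\<Sum>i\<in>I - J. a i))) / 2 ^ card I"

lemma sign_mean_empty [simp]: "sign_mean {} a f = f 0"
  by (simp add: sign_mean_def)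

lemma sign_mean_insert:
  assumes "finite I" "i \<notin> I"
  shows "sign_mean (insert i I) a f = (sign_mean I a (\<lambda>x. f (x + a i)) + sign_mean I a (\<lambda>x. f (x - a i))) / 2"
proof -
  have fin: "finite J" if "J \<in> Pow I" for J using that assms(1) finite_subset by auto
  have inj: "inj_on (insert i) (Pow I)" using assms(2) by (auto simp: inj_on_def)
  have 1: "(\<Sum>J\<in>Pow I. f ((\<Sum>i\<in>J. a i) - (\<Sum>i\<in>insert i I - J. a i)))
      = (\<Sum>J\<in>Pow I. f ((\<Sum>i\<in>J. a i) - (\<Sum>i\<in>I - J. a i) - a i))"
  proof (rule sum.cong)
    fix J assume "J \<in> Pow I"
    then have "insert i I - J = insert i (I - J)" using assms(2) by auto
    then show "f ((\<Sum>i\<in>J. a i) - (\<Sum>i\<in>insert i I - J. a i)) = f ((\<Sum>i\<in>J. a i) - (\<Sum>i\<in>I - J. a i) - a i)"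
      using assms by (simp add: algebra_simps)
  qed simp
  have 2: "(\<Sum>J\<in>insert i ` Pow I. f ((\<Sum>i\<in>J. a i) - (\<Sum>i\<in>insert i I - J. a i)))
      = (\<Sum>J\<in>Pow I. f ((\<Sum>i\<in>J. a i) - (\<Sum>i\<in>I - J. a i) + a i))"
    unfolding sum.reindex[OF inj] o_def
  proof (rule sum.cong)
    fix J assume J: "J \<in> Pow I"
    then have "insert i I - insert i J = I - J" "i \<notin> J" using assms(2) by auto
    then show "f ((\<Sum>i\<in>insert i J. a i) - (\<Sum>i\<in>insert i I - insert i J. a i)) = f ((\<Sum>i\<in>J. a i) - (\<Sum>i\<in>I - J. a i) + a i)"
      using fin[OF J] by (simp add: algebra_simps)
  qed simp
  have disj: "Pow I \<inter> insert i ` Pow I = {}" using assms(2) by auto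
  have "sign_mean (insert i I) a f
    = ((\<Sum>J\<in>Pow I. f ((\<Sum>i\<in>J. a i) - (\<Sum>i\<in>I - J. a i) - a i))
       + (\<Sum>J\<in>Pow I. f ((\<Sum>i\<in>J. a i) - (\<Sum>i\<in>I - J. a i) + a i))) / 2 ^ card (insert i I)"
    unfolding sign_mean_def Pow_insert
    by (subst sum.union_disjoint) (use assms disj in \<open>simp_all only: 1 2 finite_Pow_iff finite_imageI\<close>)
  then show ?thesis using assms by (simp add: sign_mean_def add.commute add_divide_distrib)
qed

lemma sign_mean_add: "sign_mean I a (\<lambda>x. f x + g x) = sign_mean I a f + sign_mean I a g"
  by (simp add: sign_mean_def sum.distrib add_divide_distrib)

lemma sign_mean_diff: "sign_mean I a (\<lambda>x. f x - g x) = sign_mean I a f - sign_mean I a g"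
  by (simp add: sign_mean_def sum_subtractf diff_divide_distrib)

lemma sign_mean_cmult: "sign_mean I a (\<lambda>x. c * f x) = c * sign_mean I a f"
  by (simp add: sign_mean_def sum_distrib_left)

lemma sign_mean_mono: "(\<And>x. f x \<le> g x) \<Longrightarrow> sign_mean I a f \<le> sign_mean I a g"
  by (simp add: sign_mean_def divide_right_mono sum_mono)

lemma sign_mean_const [simp]: "finite I \<Longrightarrow> sign_mean I a (\<lambda>x. c) = c"
  by (simp add: sign_mean_def card_Pow)

lemma sign_mean_scale: "sign_mean I (\<lambda>i. c * a i) f = sign_mean I a (\<lambda>x. f (c * x))"
  by (simp add: sign_mean_def sum_distrib_left right_diff_distrib)

text \<open>For the second and fourth power and for the cosine the average is computed around an arbitrary centre
$c$, since adding a sign moves the centre to $c \pm a_i$.\<close>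
lemma sign_mean_square:
  assumes "finite I"
  shows "sign_mean I a (\<lambda>x. (c + x)\<^sup>2) = c\<^sup>2 + (\<Sum>i\<in>I. (a i)\<^sup>2)"
  using assms
proof (induction I arbitrary: c)
  case (insert i I)
  have shift: "c + (x + a i) = (c + a i) + x" "c + (x - a i) = (c - a i) + x" for x
    by simp_all
  show ?case
    unfolding sign_mean_insert[OF insert(1,2)] shift insert(3)
    using insert(1,2) by (simp add: power2_eq_square algebra_simps)
qed simp

lemma sign_mean_fourth_power:
  assumes "finite I"
  shows "sign_mean I a (\<lambda>x. (c + x)^4)
    = c^4 + 6 * c\<^sup>2 * (\<Sum>i\<in>I. (a i)\<^sup>2) + 3 * (\<Sum>i\<in>I. (a i)\<^sup>2)\<^sup>2 - 2 * (\<Sum>i\<in>I. (a i)^4)"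
  using assms
proof (induction I arbitrary: c)
  case (insert i I)
  have shift: "c + (x + a i) = (c + a i) + x" "c + (x - a i) = (c - a i) + x" for x
    by simp_all
  have "((c + b)^4 + 6 * (c + b)\<^sup>2 * S + 3 * S\<^sup>2 - 2 * Q)
      + ((c - b)^4 + 6 * (c - b)\<^sup>2 * S + 3 * S\<^sup>2 - 2 * Q)
    = 2 * (c^4 + 6 * c\<^sup>2 * (b\<^sup>2 + S) + 3 * (b\<^sup>2 + S)\<^sup>2 - 2 * (b^4 + Q))" for b S Q :: real
    by (simp add: power2_eq_square power4_eq_xxxx algebra_simps)
  from this[of "a i"] show ?case
    unfolding sign_mean_insert[OF insert(1,2)] shift insert(3) sum.insert[OF insert(1,2)] by simp
qed simp

lemma sign_mean_cos:
  assumes "finite I"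
  shows "sign_mean I a (\<lambda>x. cos (c + x)) = cos c * (\<Prod>i\<in>I. cos (a i))"
  using assms
proof (induction I arbitrary: c)
  case (insert i I)
  have shift: "c + (x + a i) = (c + a i) + x" "c + (x - a i) = (c - a i) + x" for x
    by simp_all
  show ?case
    unfolding sign_mean_insert[OF insert(1,2)] shift insert(3)
    using insert(1,2) by (simp add: cos_add cos_diff algebra_simps)
qed simp

section \<open>Domination of the fourth-order cosine remainder\<close>
definition cos_remainder :: "real \<Rightarrow> real" where
  "cos_remainder t = 1 - t\<^sup>2/2 + t^4/24 - cos t"

lemma cos_remainder_nonneg: "0 \<le> cos_remainder t"
  using cos_upper_Taylor4[of t] by (simp add: cos_remainder_def)

text \<open>With $v = t^2/2$ this is the expectation of the cosine remainder at $tG$ for a standard Gaussian $G$.\<close>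
definition gauss_remainder :: "real \<Rightarrow> real" where
  "gauss_remainder v = 1 - v + v\<^sup>2/2 - exp (- v)"

text \<open>The Gaussian remainder is convex in $v \ge 0$, hence lies above its tangent at $v$.\<close>
lemma gauss_remainder_tangent:
  assumes "0 \<le> w" "w \<le> v"
  shows "gauss_remainder v - (v - w) * (v - 1 + exp (-v)) \<le> gauss_remainder w"
proof -
  define d where "d = v - w"
  have d: "0 \<le> d" "d \<le> v" using assms by (auto simp: d_def)
  have w: "w = v - d" by (simp add: d_def)
  let ?f = "\<lambda>d::real. d\<^sup>2 / 2 - 1 + (1 + d) * exp (-d)"
  have "?f 0 \<le> ?f d"
  proof (rule DERIV_nonneg_imp_nondecreasing[OF d(1)])
    fix x :: real assume "0 \<le> x" "x \<le> d"
    then have "0 \<le> x - x * exp (-x)" using mult_left_mono[of "exp (-x)" 1 x] by simp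
    moreover have "(?f has_real_derivative x - x * exp (-x)) (at x)"
      by (rule derivative_eq_intros refl | simp)+ (simp add: algebra_simps)
    ultimately show "\<exists>y. (?f has_real_derivative y) (at x) \<and> 0 \<le> y" by blast
  qed
  then have 1: "1 - (1 + d) * exp (-d) \<le> d\<^sup>2 / 2" by simp
  have "exp (-v) * (exp d - 1 - d) \<le> exp (-d) * (exp d - 1 - d)"
    using d exp_ge_add_one_self[of d] by (intro mult_right_mono) (simp_all add: algebra_simps)
  also have "\<dots> = 1 - (1 + d) * exp (-d)" by (simp add: algebra_simps exp_minus)
  finally have 2: "exp (-v) * (exp d - 1 - d) \<le> d\<^sup>2 / 2" using 1 by linarith
  have "(1 - (v - d) + (v - d)\<^sup>2/2 - e * E) - ((1 - v + v\<^sup>2/2 - e) - d * (v - 1 + e))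
      = d\<^sup>2 / 2 - e * (E - 1 - d)" for e E :: real
    by (simp add: field_simps power2_eq_square)
  from this[of "exp (-v)" "exp d"]
  have "gauss_remainder w - (gauss_remainder v - d * (v - 1 + exp (-v)))
      = d\<^sup>2 / 2 - exp (-v) * (exp d - 1 - d)"
    by (simp add: gauss_remainder_def w flip: exp_add)
  with 2 show ?thesis by (simp add: d_def)
qed

lemma sum_fourth_le_one:
  fixes a :: "'i \<Rightarrow> real"
  assumes "finite I" "(\<Sum>i\<in>I. (a i)\<^sup>2) = 1"
  shows "(\<Sum>i\<in>I. (a i)^4) \<le> 1"
proof -
  have "(\<Sum>i\<in>I. (a i)^4) = (\<Sum>i\<in>I. (a i)\<^sup>2 * (a i)\<^sup>2)" by (simp flip: power_add)
  also have "\<dots> \<le> (\<Sum>i\<in>I. (a i)\<^sup>2 * 1)"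
  proof (intro sum_mono mult_left_mono)
    fix i assume "i \<in> I"
    then show "(a i)\<^sup>2 \<le> 1" using member_le_sum[of i I "\<lambda>i. (a i)\<^sup>2"] assms by simp
  qed simp
  finally show ?thesis using assms by simp
qed

text \<open>This is where the factor $1 - x/6$ comes from. The exact value of the left-hand side is
$g(v) - \frac{x v^2}{3} + e^{-v} - \prod_i \cos(l a_i)$ with $v = l^2/2$ and $g$ the Gaussian
remainder, and \<open>prod_cos_lower\<close> bounds the last difference in such a way that one gets
$g(v) - 2 \frac{x}{6} v g'(v)$ plus the correction $x^2v^3e^{-v}/90$. The tangent of $g$ at $v$,
evaluated at $(1 - x/6)^2v$, is $g(v) - 2\frac{x}{6}vg'(v) + \frac{x^2}{36}vg'(v)$, and its quadratic term
absorbs the correction because $g'(v) = v - 1 + e^{-v} \ge v^2e^{-v}/2$.\<close>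
lemma sign_mean_cos_remainder_le:
  fixes a :: "'i \<Rightarrow> real" and l :: real
  assumes "finite I" "(\<Sum>i\<in>I. (a i)\<^sup>2) = 1"
  defines "x \<equiv> \<Sum>i\<in>I. (a i)^4"
  shows "sign_mean I a (\<lambda>s. cos_remainder (l * s)) \<le> gauss_remainder (((1 - x/6) * l)\<^sup>2 / 2)"
proof (cases "l = 0")
  case True
  then show ?thesis using assms(1) by (simp add: cos_remainder_def gauss_remainder_def)
next
  case False
  define v where "v = l\<^sup>2 / 2"
  have v: "v > 0" using False by (simp add: v_def)
  have x: "0 \<le> x" "x \<le> 1" using sum_fourth_le_one[OF assms(1,2)] by (auto simp: x_def sum_nonneg)
  define P where "P = (\<Prod>i\<in>I. cos (l * a i))"
  have Vs: "(\<Sum>i\<in>I. (l * a i)\<^sup>2) = 2 * v" "(\<Sum>i\<in>I. (l * a i)^4) = 4 * v\<^sup>2 * x"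
    using assms(2) by (simp_all add: power_mult_distrib x_def v_def power_divide flip: sum_distrib_left power_mult)
  have "1 - exp v * P \<le> 4 * v\<^sup>2 * x / (6 * (2 * v)) * (exp v - 1) + (4 * v\<^sup>2 * x)\<^sup>2 / (720 * (2 * v))"
    using prod_cos_lower[of I "\<lambda>i. l * a i"] assms(1) v by (simp add: Vs P_def)
  also have "\<dots> = x * v / 3 * (exp v - 1) + x\<^sup>2 * v^3 / 90"
    using v by (simp add: power2_eq_square power3_eq_cube mult_ac)
  finally have "exp (-v) * (1 - exp v * P) \<le> exp (-v) * (x * v / 3 * (exp v - 1) + x\<^sup>2 * v^3 / 90)"
    by (intro mult_left_mono) auto
  then have P: "exp (-v) - P \<le> x * v / 3 * (1 - exp (-v)) + x\<^sup>2 * v / 90 * (v\<^sup>2 * exp (-v))"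
    by (simp add: algebra_simps exp_minus power2_eq_square power3_eq_cube)
  have "exp (-v) * (v\<^sup>2 / 2) \<le> exp (-v) * (1 - exp v + v * exp v)"
    using half_square_le[of v] v by (intro mult_left_mono) auto
  then have Jv: "v\<^sup>2 * exp (-v) / 2 \<le> v - 1 + exp (-v)"
    by (simp add: algebra_simps exp_minus)
  have "sign_mean I a (\<lambda>s. cos_remainder (l * s))
      = sign_mean I (\<lambda>i. l * a i) (\<lambda>t. 1 - (1/2) * (0 + t)\<^sup>2 + (1/24) * (0 + t)^4 - cos (0 + t))"
    unfolding sign_mean_scale by (simp add: cos_remainder_def)
  also have "\<dots> = 1 - v + v\<^sup>2/2 - x * v\<^sup>2 / 3 - P"
    unfolding sign_mean_add sign_mean_diff sign_mean_cmult sign_mean_square[OF assms(1)] sign_mean_fourth_power[OF assms(1)]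
      sign_mean_cos[OF assms(1)] sign_mean_const[OF assms(1)]
    unfolding Vs P_def by (simp add: power2_eq_square)
  also have "\<dots> = gauss_remainder v - x * v\<^sup>2/3 + (exp (-v) - P)" by (simp add: gauss_remainder_def)
  also have "\<dots> \<le> gauss_remainder v - x * v\<^sup>2/3 + (x * v / 3 * (1 - exp (-v)) + x\<^sup>2 * v / 90 * (v\<^sup>2 * exp (-v)))"
    using P by (rule add_left_mono)
  also have "\<dots> \<le> gauss_remainder v - x * v\<^sup>2/3 + (x * v / 3 * (1 - exp (-v)) + x\<^sup>2 * v / 36 * (v - 1 + exp (-v)))"
  proof -
    have "x\<^sup>2 * v / 90 * (v\<^sup>2 * exp (-v)) = x\<^sup>2 * v / 45 * (v\<^sup>2 * exp (-v) / 2)" by simp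
    also have "\<dots> \<le> x\<^sup>2 * v / 36 * (v - 1 + exp (-v))"
      using Jv v by (intro mult_mono) (auto intro!: divide_left_mono)
    finally show ?thesis by simp
  qed
  also have "\<dots> = gauss_remainder v - (v - (1 - x/6)\<^sup>2 * v) * (v - 1 + exp (-v))"
    by (simp add: field_simps power2_eq_square)
  also have "\<dots> \<le> gauss_remainder ((1 - x/6)\<^sup>2 * v)"
  proof (rule gauss_remainder_tangent)
    have "(1 - x/6)\<^sup>2 \<le> 1" using x by (simp add: power_le_one)
    then show "(1 - x/6)\<^sup>2 * v \<le> v" using v by simp
  qed (use v in auto)
  finally show ?thesis by (simp add: v_def power_mult_distrib)
qed

section \<open>Moments of order between four and six\<close>
definition remainder_const :: "real \<Rightarrow> ennreal" where
  "remainder_const p = (\<integral>\<^sup>+l. ennreal (cos_remainder l * l powr (-1 - p)) * indicator {0<..} l \<partial>lborel)"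

lemma cos_remainder_measurable [measurable]: "cos_remainder \<in> borel_measurable borel"
  unfolding cos_remainder_def by measurable

lemma cos_remainder_minus [simp]: "cos_remainder (- t) = cos_remainder t"
  by (simp add: cos_remainder_def)

text \<open>For $4 < p < 6$ the power $|c|^p$ is, up to a constant, a positive mixture over $l$ of the functions
$c \mapsto 1 - \frac{(lc)^2}{2} + \frac{(lc)^4}{24} - \cos(lc)$: substitute $l \to l/|c|$. The range of $p$
is what makes the constant finite: the remainder is of order $l^6$ at $0$ and $l^4$ at infinity.\<close>
lemma nn_integral_cos_remainder:
  assumes "p > 0"
  shows "(\<integral>\<^sup>+l. ennreal (cos_remainder (l * c) * l powr (-1 - p)) * indicator {0<..} l \<partial>lborel)
    = ennreal (\<bar>c\<bar> powr p) * remainder_const p"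
proof (cases "c = 0")
  case True
  then show ?thesis using assms by (simp add: cos_remainder_def)
next
  case False
  define d where "d = \<bar>c\<bar>"
  have d: "d > 0" using False by (simp add: d_def)
  have "cos_remainder (l * c) = cos_remainder (l * d)" for l
    using cos_remainder_minus[of "l * c"] by (auto simp: d_def abs_if)
  then have "(\<integral>\<^sup>+l. ennreal (cos_remainder (l * c) * l powr (-1 - p)) * indicator {0<..} l \<partial>lborel)
    = (\<integral>\<^sup>+l. ennreal (cos_remainder (l * d) * l powr (-1 - p)) * indicator {0<..} l \<partial>lborel)" by simp
  also have "\<dots> = ennreal \<bar>1/d\<bar> * (\<integral>\<^sup>+l. ennreal (cos_remainder ((0 + 1/d * l) * d) * (0 + 1/d * l) powr (-1 - p)) * indicator {0<..} (0 + 1/d * l) \<partial>lborel)"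
    by (rule nn_integral_real_affine) (use d in auto)
  also have "(\<integral>\<^sup>+l. ennreal (cos_remainder ((0 + 1/d * l) * d) * (0 + 1/d * l) powr (-1 - p)) * indicator {0<..} (0 + 1/d * l) \<partial>lborel)
     = (\<integral>\<^sup>+l. ennreal (d powr (1 + p)) * (ennreal (cos_remainder l * l powr (-1 - p)) * indicator {0<..} l) \<partial>lborel)"
  proof (rule nn_integral_cong)
    fix l :: real
    show "ennreal (cos_remainder ((0 + 1/d * l) * d) * (0 + 1/d * l) powr (-1 - p)) * indicator {0<..} (0 + 1/d * l)
      = ennreal (d powr (1 + p)) * (ennreal (cos_remainder l * l powr (-1 - p)) * indicator {0<..} l)"
    proof (cases "l > 0")
      case True
      have "(l / d) powr (-1 - p) = l powr (-1 - p) * d powr (1 + p)"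
        using True d by (simp add: powr_divide powr_minus_divide flip: powr_minus) (simp add: powr_minus field_simps flip: powr_add)
      then show ?thesis using True d
        by (simp add: ennreal_mult'[symmetric] cos_remainder_nonneg mult_ac)
    qed (use d in \<open>auto simp: zero_less_divide_iff\<close>)
  qed
  also have "\<dots> = ennreal (d powr (1 + p)) * remainder_const p"
    unfolding remainder_const_def by (rule nn_integral_cmult) measurable
  also have "ennreal \<bar>1/d\<bar> * (ennreal (d powr (1 + p)) * remainder_const p) = ennreal (d powr p) * remainder_const p"
  proof -
    have "ennreal \<bar>1/d\<bar> * ennreal (d powr (1 + p)) = ennreal (d powr p)"
      using d by (simp add: ennreal_mult'[symmetric] powr_add)
    then show ?thesis by (simp add: mult.assoc[symmetric])
  qed
  finally show ?thesis by (simp add: d_def)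
qed

lemma remainder_const_finite:
  assumes "4 < p" "p < 6"
  shows "remainder_const p < \<infinity>"
proof -
  have "remainder_const p \<le> (\<integral>\<^sup>+l. (ennreal (l powr (5 - p)) * indicator {0..1} l) + 3 * (ennreal (l powr (3 - p)) * indicator {1..} l) \<partial>lborel)"
    unfolding remainder_const_def
  proof (rule nn_integral_mono)
    fix l :: real
    show "ennreal (cos_remainder l * l powr (-1 - p)) * indicator {0<..} l
      \<le> (ennreal (l powr (5 - p)) * indicator {0..1} l) + 3 * (ennreal (l powr (3 - p)) * indicator {1..} l)"
    proof (cases "l > 0")
      case l: True
      show ?thesis
      proof (cases "l \<le> 1")
        case True
        have "cos_remainder l \<le> l powr 6"
        proof -
          have "cos_remainder l \<le> l^6 / 720" using cos_lower_Taylor4[of l] by (simp add: cos_remainder_def)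
          also have "\<dots> \<le> l^6" using l by simp
          finally show ?thesis using l by (simp add: powr_numeral)
        qed
        then have "cos_remainder l * l powr (-1 - p) \<le> l powr 6 * l powr (-1 - p)" by (intro mult_right_mono) auto
        also have "\<dots> = l powr (5 - p)" by (simp flip: powr_add)
        finally have "ennreal (cos_remainder l * l powr (-1 - p)) \<le> ennreal (l powr (5 - p))" by (rule ennreal_leI)
        then show ?thesis using l True by (simp add: add_increasing2)
      next
        case False
        have "cos_remainder l \<le> 3 * l powr 4"
        proof -
          have "1 \<le> l^4" using False by (simp add: one_le_power)
          moreover have "cos_remainder l \<le> 2 + l^4/24"
            using add_mono[OF cos_ge_minus_one[of l] zero_le_power2[of l]] add_mono[OF cos_ge_minus_one[of l], of 0 "l\<^sup>2/2"]
            by (simp add: cos_remainder_def)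
          ultimately have "cos_remainder l \<le> 3 * l^4" by linarith
          then show ?thesis using l by (simp add: powr_numeral)
        qed
        then have "cos_remainder l * l powr (-1 - p) \<le> 3 * l powr 4 * l powr (-1 - p)" by (intro mult_right_mono) auto
        also have "\<dots> = 3 * l powr (3 - p)" by (simp add: mult.assoc flip: powr_add)
        finally have "ennreal (cos_remainder l * l powr (-1 - p)) \<le> 3 * ennreal (l powr (3 - p))"
          by (metis ennreal_leI ennreal_mult' ennreal_numeral zero_le_numeral)
        then show ?thesis using l False by auto
      qed
    qed auto
  qed
  also have "\<dots> = (\<integral>\<^sup>+l. ennreal (l powr (5 - p)) * indicator {0..1} l \<partial>lborel) + 3 * (\<integral>\<^sup>+l. ennreal (l powr (3 - p)) * indicator {1..} l \<partial>lborel)"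
    by (simp add: nn_integral_add nn_integral_cmult)
  also have "(\<integral>\<^sup>+l. ennreal (l powr (5 - p)) * indicator {0..1} l \<partial>lborel) = ennreal (1 powr (5 - p + 1) / (5 - p + 1))"
    by (rule nn_integral_has_integral_lebesgue'[OF _ has_integral_powr_from_0]) (use assms in auto)
  also have "(\<integral>\<^sup>+l. ennreal (l powr (3 - p)) * indicator {1..} l \<partial>lborel) = ennreal (- (1 powr (3 - p + 1)) / (3 - p + 1))"
    by (rule nn_integral_has_integral_lebesgue'[OF _ has_integral_powr_to_inf]) (use assms in auto)
  finally show ?thesis
    by (auto simp: ennreal_mult_less_top intro: order.strict_trans1)
qed

lemma remainder_const_pos: "0 < remainder_const p"
proof -
  \<comment> \<open>On \<open>{6..7}\<close> the polynomial part of the remainder exceeds the cosine by a safe margin.\<close>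
  define m where "m = min (6 powr (-1-p)) (7 powr (-1-p))"
  have "ennreal m * emeasure lborel {6..7::real} = (\<integral>\<^sup>+l. ennreal m * indicator {6..7::real} l \<partial>lborel)"
    by (simp add: nn_integral_cmult)
  also have "\<dots> \<le> remainder_const p"
    unfolding remainder_const_def
  proof (rule nn_integral_mono)
    fix l :: real
    show "ennreal m * indicator {6..7} l \<le> ennreal (cos_remainder l * l powr (-1 - p)) * indicator {0<..} l"
    proof (cases "l \<in> {6..7}")
      case True
      have "6 * 6 \<le> l * l" using True by (intro mult_mono) auto
      then have "36 * 24 \<le> l\<^sup>2 * (l\<^sup>2 - 12)" by (intro mult_mono) (auto simp: power2_eq_square)
      then have l4: "1 \<le> l^4/24 - l\<^sup>2/2" by (simp add: right_diff_distrib flip: power_add)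
      then have 1: "1 \<le> cos_remainder l" using add_mono[OF l4 cos_le_one[of l]] by (simp add: cos_remainder_def)
      have "m \<le> l powr (-1 - p)"
      proof (cases "-1 - p \<ge> 0")
        case pos: True
        have "6 powr (-1 - p) \<le> l powr (-1 - p)" using True pos by (intro powr_mono2) auto
        then show ?thesis by (simp add: m_def)
      next
        case False
        then have "7 powr (-1 - p) \<le> l powr (-1 - p)" using True by (intro powr_mono2') auto
        then show ?thesis by (simp add: m_def)
      qed
      then have "m \<le> cos_remainder l * l powr (-1 - p)"
        using mult_mono[OF 1, of m "l powr (-1-p)"] 1 by (simp add: m_def)
      then show ?thesis using True by (simp add: ennreal_leI)
    qed auto
  qed
  finally have "ennreal m \<le> remainder_const p" by simp
  moreover have "0 < m" by (simp add: m_def)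
  ultimately show ?thesis using ennreal_less_zero_iff[of m] by (metis less_le_trans)
qed

lemma integral_std_normal_cos:
  "has_bochner_integral lborel (\<lambda>x. std_normal_density x * cos (t * x)) (exp (- t\<^sup>2 / 2))"
proof -
  have int: "integrable lborel (\<lambda>x. std_normal_density x * cos (t * x))"
    by (rule Bochner_Integration.integrable_bound[OF integrable_std_normal_moment_abs[of 0]])
       (auto simp: abs_mult mult_left_le)
  have "complex_of_real (exp (- t\<^sup>2 / 2)) = (CLINT x|std_normal_distribution. iexp (t * x))"
    using char_std_normal_distribution by (simp add: char_def fun_eq_iff)
  also have "\<dots> = (CLINT x|lborel. std_normal_density x *\<^sub>R iexp (t * x))"
    by (subst integral_density) auto
  finally have "exp (- t\<^sup>2 / 2) = Re (CLINT x|lborel. std_normal_density x *\<^sub>R iexp (t * x))"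
    by (metis Re_complex_of_real)
  also have "\<dots> = (LINT x|lborel. Re (std_normal_density x *\<^sub>R iexp (t * x)))"
  proof (rule integral_Re[symmetric])
    show "integrable lborel (\<lambda>x. std_normal_density x *\<^sub>R iexp (t * x))"
      by (rule Bochner_Integration.integrable_bound[OF integrable_std_normal_moment_abs[of 0]])
         auto
  qed
  also have "\<dots> = (LINT x|lborel. std_normal_density x * cos (t * x))"
    by (simp add: Re_exp)
  finally show ?thesis using int by (simp add: has_bochner_integral_iff)
qed

lemma nn_integral_std_normal_cos_remainder:
  "(\<integral>\<^sup>+x. ennreal (std_normal_density x * cos_remainder (t * x)) \<partial>lborel) = ennreal (gauss_remainder (t\<^sup>2 / 2))"
proof -
  have "has_bochner_integral lborel (\<lambda>x. std_normal_density x * x^(2*0) - t\<^sup>2/2 * (std_normal_density x * x^(2*1))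
      + t^4/24 * (std_normal_density x * x^(2*2)) - std_normal_density x * cos (t * x))
     (fact (2 * 0) / (2^0 * fact 0) - t\<^sup>2/2 * (fact (2 * 1) / (2^1 * fact 1)) + t^4/24 * (fact (2 * 2) / (2^2 * fact 2)) - exp (- t\<^sup>2 / 2))"
    by (intro has_bochner_integral_add has_bochner_integral_diff has_bochner_integral_mult_right
         std_normal_moment_even integral_std_normal_cos)
  also have "(\<lambda>x. std_normal_density x * x^(2*0) - t\<^sup>2/2 * (std_normal_density x * x^(2*1))
      + t^4/24 * (std_normal_density x * x^(2*2)) - std_normal_density x * cos (t * x)) = (\<lambda>x. std_normal_density x * cos_remainder (t * x))"
    by (simp add: cos_remainder_def fun_eq_iff algebra_simps power_mult_distrib power2_eq_square)
  also have "(fact (2 * 0) / (2^0 * fact 0) - t\<^sup>2/2 * (fact (2 * 1) / (2^1 * fact 1)) + t^4/24 * (fact (2 * 2) / (2^2 * fact 2)) - exp (- t\<^sup>2 / 2))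
     = gauss_remainder (t\<^sup>2 / 2)"
    by (simp add: gauss_remainder_def fact_numeral power_divide flip: power_mult)
  finally show ?thesis
    by (subst nn_integral_eq_integral) (auto simp: has_bochner_integral_iff cos_remainder_nonneg)
qed

text \<open>Integrating \<open>sign_mean_cos_remainder_le\<close> against $l^{-1-p}$ turns the comparison of remainders into
one of $p$-th moments. On the Gaussian side this uses Tonelli's theorem.\<close>
lemma sign_mean_powr_le_nn_integral:
  fixes a :: "'i \<Rightarrow> real"
  assumes "finite I" "(\<Sum>i\<in>I. (a i)\<^sup>2) = 1" "4 < p" "p < 6"
  defines "x \<equiv> \<Sum>i\<in>I. (a i)^4"
  shows "ennreal (sign_mean I a (\<lambda>s. \<bar>s\<bar> powr p))
    \<le> (\<integral>\<^sup>+y. ennreal (std_normal_density y * ((1 - x/6) * \<bar>y\<bar>) powr p) \<partial>lborel)"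
proof -
  define b where "b = 1 - x/6"
  have b: "b > 0" using sum_fourth_le_one[OF assms(1,2)] by (simp add: b_def x_def)
  let ?K = "remainder_const p"
  let ?w = "\<lambda>l. ennreal (l powr (-1 - p)) * indicator {0<..} l"
  let ?S = "\<lambda>J. (\<Sum>i\<in>J. a i) - (\<Sum>i\<in>I - J. a i)"
  have "ennreal (sign_mean I a (\<lambda>s. \<bar>s\<bar> powr p)) * ?K
     = (\<Sum>J\<in>Pow I. ennreal (1 / 2 ^ card I) * (ennreal (\<bar>?S J\<bar> powr p) * ?K))"
  proof -
    have "ennreal (sign_mean I a (\<lambda>s. \<bar>s\<bar> powr p)) = ennreal (\<Sum>J\<in>Pow I. 1 / 2 ^ card I * \<bar>?S J\<bar> powr p)"
      by (simp add: sign_mean_def sum_divide_distrib)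
    also have "\<dots> = (\<Sum>J\<in>Pow I. ennreal (1 / 2 ^ card I * \<bar>?S J\<bar> powr p))"
      by (rule sum_ennreal[symmetric]) simp
    finally show ?thesis by (simp only: sum_distrib_right ennreal_mult' mult.assoc zero_le_divide_1_iff zero_le_power zero_le_numeral)
  qed
  also have "\<dots> = (\<Sum>J\<in>Pow I. ennreal (1 / 2 ^ card I) * (\<integral>\<^sup>+l. ennreal (cos_remainder (l * ?S J) * l powr (-1 - p)) * indicator {0<..} l \<partial>lborel))"
    using assms(3) by (subst nn_integral_cos_remainder) auto
  also have "\<dots> = (\<integral>\<^sup>+l. (\<Sum>J\<in>Pow I. ennreal (1 / 2 ^ card I) * (ennreal (cos_remainder (l * ?S J) * l powr (-1 - p)) * indicator {0<..} l)) \<partial>lborel)"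
    by (subst nn_integral_sum) (auto simp: nn_integral_cmult)
  also have "\<dots> = (\<integral>\<^sup>+l. ennreal (sign_mean I a (\<lambda>s. cos_remainder (l * s)) * l powr (-1 - p)) * indicator {0<..} l \<partial>lborel)"
  proof (rule nn_integral_cong)
    fix l :: real
    show "(\<Sum>J\<in>Pow I. ennreal (1 / 2 ^ card I) * (ennreal (cos_remainder (l * ?S J) * l powr (-1 - p)) * indicator {0<..} l))
      = ennreal (sign_mean I a (\<lambda>s. cos_remainder (l * s)) * l powr (-1 - p)) * indicator {0<..} l"
      by (simp add: sign_mean_def sum_divide_distrib sum_distrib_right cos_remainder_nonneg split: split_indicator
          flip: ennreal_mult')
  qed
  also have "\<dots> \<le> (\<integral>\<^sup>+l. ennreal (gauss_remainder ((b * l)\<^sup>2 / 2) * l powr (-1 - p)) * indicator {0<..} l \<partial>lborel)"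
    using sign_mean_cos_remainder_le[OF assms(1,2)]
    by (intro nn_integral_mono mult_right_mono ennreal_leI) (auto simp: b_def x_def)
  also have "\<dots> = (\<integral>\<^sup>+l. (\<integral>\<^sup>+y. ennreal (std_normal_density y * cos_remainder (b * l * y)) * ?w l \<partial>lborel) \<partial>lborel)"
  proof (rule nn_integral_cong)
    fix l :: real
    have "(\<integral>\<^sup>+y. ennreal (std_normal_density y * cos_remainder (b * l * y)) * ?w l \<partial>lborel)
      = ennreal (gauss_remainder ((b * l)\<^sup>2 / 2)) * ?w l"
      unfolding nn_integral_std_normal_cos_remainder[symmetric] by (rule nn_integral_multc) measurable
    then show "ennreal (gauss_remainder ((b * l)\<^sup>2 / 2) * l powr (-1 - p)) * indicator {0<..} l
      = (\<integral>\<^sup>+y. ennreal (std_normal_density y * cos_remainder (b * l * y)) * ?w l \<partial>lborel)"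
      by (simp add: ennreal_mult'' mult.assoc)
  qed
  also have "\<dots> = (\<integral>\<^sup>+y. (\<integral>\<^sup>+l. ennreal (std_normal_density y * cos_remainder (b * l * y)) * ?w l \<partial>lborel) \<partial>lborel)"
    by (rule lborel_pair.Fubini') measurable
  also have "\<dots> = (\<integral>\<^sup>+y. ennreal (std_normal_density y) * (ennreal (\<bar>b * y\<bar> powr p) * ?K) \<partial>lborel)"
  proof (rule nn_integral_cong)
    fix y :: real
    have "(\<integral>\<^sup>+l. ennreal (std_normal_density y * cos_remainder (b * l * y)) * ?w l \<partial>lborel)
      = (\<integral>\<^sup>+l. ennreal (std_normal_density y) * (ennreal (cos_remainder (l * (b * y)) * l powr (-1 - p)) * indicator {0<..} l) \<partial>lborel)"
      by (intro nn_integral_cong) (simp add: cos_remainder_nonneg ennreal_mult' mult_ac split: split_indicator)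
    also have "\<dots> = ennreal (std_normal_density y) * (\<integral>\<^sup>+l. (ennreal (cos_remainder (l * (b * y)) * l powr (-1 - p)) * indicator {0<..} l) \<partial>lborel)"
      by (rule nn_integral_cmult) measurable
    finally show "(\<integral>\<^sup>+l. ennreal (std_normal_density y * cos_remainder (b * l * y)) * ?w l \<partial>lborel)
       = ennreal (std_normal_density y) * (ennreal (\<bar>b * y\<bar> powr p) * ?K)"
      using assms(3) by (simp add: nn_integral_cos_remainder)
  qed
  also have "\<dots> = (\<integral>\<^sup>+y. ennreal (std_normal_density y * (b * \<bar>y\<bar>) powr p) * ?K \<partial>lborel)"
    using b by (intro nn_integral_cong) (simp add: abs_mult ennreal_mult' mult_ac)
  also have "\<dots> = (\<integral>\<^sup>+y. ennreal (std_normal_density y * (b * \<bar>y\<bar>) powr p) \<partial>lborel) * ?K"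
    by (rule nn_integral_multc) measurable
  finally have "ennreal (sign_mean I a (\<lambda>s. \<bar>s\<bar> powr p)) * ?K
     \<le> (\<integral>\<^sup>+y. ennreal (std_normal_density y * (b * \<bar>y\<bar>) powr p) \<partial>lborel) * ?K" .
  then show ?thesis
    using remainder_const_finite[OF assms(3,4)] remainder_const_pos[of p]
    unfolding b_def by (metis ennreal_mult_le_mult_iff infinity_ennreal_def less_irrefl mult.commute not_gr_zero)
qed

section \<open>Absolute moments of the Gaussian\<close>
definition gauss_abs_moment :: "real \<Rightarrow> real" where
  "gauss_abs_moment p = (LINT x|lborel. std_normal_density x * \<bar>x\<bar> powr p)"

lemma integrable_gauss_abs_moment:
  assumes "0 \<le> p"
  shows "integrable lborel (\<lambda>x. std_normal_density x * \<bar>x\<bar> powr p)"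
proof (rule Bochner_Integration.integrable_bound)
  show "integrable lborel (\<lambda>x. std_normal_density x * \<bar>x\<bar>^0 + std_normal_density x * \<bar>x\<bar>^(nat \<lceil>p\<rceil>))"
    by (intro Bochner_Integration.integrable_add integrable_std_normal_moment_abs)
  have bound: "\<bar>x\<bar> powr p \<le> 1 + \<bar>x\<bar> ^ nat \<lceil>p\<rceil>" for x :: real
  proof (cases "\<bar>x\<bar> \<le> 1")
    case True
    then have "\<bar>x\<bar> powr p \<le> 1" using assms by (intro powr_le1) auto
    then show ?thesis using zero_le_power[of "\<bar>x\<bar>" "nat \<lceil>p\<rceil>"] by linarith
  next
    case False
    have "p \<le> real (nat \<lceil>p\<rceil>)" by (rule real_nat_ceiling_ge)
    then have "\<bar>x\<bar> powr p \<le> \<bar>x\<bar> powr real (nat \<lceil>p\<rceil>)" using False by (intro powr_mono) auto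
    then show ?thesis using False by (simp add: powr_realpow)
  qed
  show "AE x in lborel. norm (std_normal_density x * \<bar>x\<bar> powr p)
      \<le> norm (std_normal_density x * \<bar>x\<bar>^0 + std_normal_density x * \<bar>x\<bar>^(nat \<lceil>p\<rceil>))"
  proof (intro AE_I2)
    fix x :: real
    have "std_normal_density x * \<bar>x\<bar> powr p \<le> std_normal_density x * (1 + \<bar>x\<bar> ^ nat \<lceil>p\<rceil>)"
      using bound by (intro mult_left_mono) auto
    then show "norm (std_normal_density x * \<bar>x\<bar> powr p)
      \<le> norm (std_normal_density x * \<bar>x\<bar>^0 + std_normal_density x * \<bar>x\<bar>^(nat \<lceil>p\<rceil>))"
      by (simp add: abs_mult distrib_left)
  qed
qed measurable

lemma gauss_abs_moment_nonneg: "0 \<le> gauss_abs_moment p"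
  unfolding gauss_abs_moment_def by (intro integral_nonneg_AE) auto

lemma nn_integral_gauss_abs_moment:
  assumes "0 \<le> p" "0 \<le> b"
  shows "(\<integral>\<^sup>+y. ennreal (std_normal_density y * (b * \<bar>y\<bar>) powr p) \<partial>lborel) = ennreal (b powr p * gauss_abs_moment p)"
proof -
  have "(\<integral>\<^sup>+y. ennreal (std_normal_density y * (b * \<bar>y\<bar>) powr p) \<partial>lborel)
     = (\<integral>\<^sup>+y. ennreal (b powr p * (std_normal_density y * \<bar>y\<bar> powr p)) \<partial>lborel)"
    using assms by (intro nn_integral_cong) (simp add: powr_mult mult_ac)
  also have "\<dots> = ennreal (LINT y|lborel. b powr p * (std_normal_density y * \<bar>y\<bar> powr p))"
    using assms by (intro nn_integral_eq_integral integrable_mult_right integrable_gauss_abs_moment) auto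
  finally show ?thesis by (simp add: gauss_abs_moment_def)
qed

lemma gauss_abs_moment_4: "gauss_abs_moment 4 = 3"
proof -
  have "\<bar>x\<bar> powr 4 = x^(2*2)" for x :: real by (cases "x = 0") (simp_all add: powr_numeral)
  then show ?thesis
    using integral_std_normal_moment_even[of 2] by (simp add: gauss_abs_moment_def fact_numeral)
qed

text \<open>The rescaled density satisfies $\varphi(\sqrt t\,x) = \varphi(x)e^{-(t-1)x^2/2} \ge
\varphi(x)(1 - (t-1)x^2/2)$. Integrating against $|x|^p$ gives
$t^{-(p+1)/2} m_p \ge m_p - \frac{t-1}{2}m_{p+2}$, and $t \to 1$ yields the claim.\<close>
lemma gauss_abs_moment_add_2:
  assumes "0 \<le> p"
  shows "(p + 1) * gauss_abs_moment p \<le> gauss_abs_moment (p + 2)"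
proof -
  define r where "r = (p + 1) / 2"
  have two_r: "2 * r = p + 1" by (simp add: r_def)
  have scaled: "gauss_abs_moment p * ((1 - t powr (-r)) / (t - 1)) \<le> gauss_abs_moment (p + 2) / 2" if "t > 1" for t
  proof -
    define c where "c = sqrt t"
    have c: "c > 1" "c\<^sup>2 = t" using that by (auto simp: c_def)
    have cr: "c powr (-(p+1)) = t powr (-r)"
    proof -
      have "t = c powr 2" using c by (simp add: powr_numeral)
      then have "t powr (-r) = c powr (2 * (-r))" by (simp add: powr_powr)
      moreover have "2 * (-r) = -(p + 1)" using two_r by simp
      ultimately show ?thesis by metis
    qed
    have eq: "gauss_abs_moment p = c powr (p + 1) * (LINT x|lborel. std_normal_density (c * x) * \<bar>x\<bar> powr p)"
    proof -
      have "gauss_abs_moment p = \<bar>c\<bar> *\<^sub>R (LINT x|lborel. std_normal_density (0 + c * x) * \<bar>0 + c * x\<bar> powr p)"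
        unfolding gauss_abs_moment_def by (rule lborel_integral_real_affine) (use c in auto)
      also have "\<dots> = c * (LINT x|lborel. c powr p * (std_normal_density (c * x) * \<bar>x\<bar> powr p))"
        using c by (simp add: abs_mult powr_mult mult_ac)
      also have "\<dots> = c * (c powr p * (LINT x|lborel. std_normal_density (c * x) * \<bar>x\<bar> powr p))"
        by simp
      finally show ?thesis using c by (simp add: powr_add)
    qed
    have int: "integrable lborel (\<lambda>x. std_normal_density (c * x) * \<bar>x\<bar> powr p)"
    proof (rule Bochner_Integration.integrable_bound[OF integrable_gauss_abs_moment[OF assms]])
      show "AE x in lborel. norm (std_normal_density (c * x) * \<bar>x\<bar> powr p) \<le> norm (std_normal_density x * \<bar>x\<bar> powr p)"
      proof (intro AE_I2)
        fix x :: real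
        have "x\<^sup>2 * 1 \<le> x\<^sup>2 * c\<^sup>2" using c by (intro mult_left_mono) auto
        then have "std_normal_density (c * x) \<le> std_normal_density x"
          by (simp add: normal_density_def power_mult_distrib divide_right_mono mult.commute)
        then show "norm (std_normal_density (c * x) * \<bar>x\<bar> powr p) \<le> norm (std_normal_density x * \<bar>x\<bar> powr p)"
          by (simp add: abs_mult mult_right_mono)
      qed
    qed measurable
    have pw: "\<bar>x\<bar> powr (p + 2) = \<bar>x\<bar> powr p * x\<^sup>2" for x :: real
      by (cases "x = 0") (simp_all add: powr_add powr_numeral)
    have "gauss_abs_moment p - (t - 1) / 2 * gauss_abs_moment (p + 2)
      = (LINT x|lborel. std_normal_density x * \<bar>x\<bar> powr p - (t - 1) / 2 * (std_normal_density x * \<bar>x\<bar> powr (p + 2)))"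
      using assms by (simp add: gauss_abs_moment_def integrable_gauss_abs_moment)
    also have "\<dots> \<le> (LINT x|lborel. std_normal_density (c * x) * \<bar>x\<bar> powr p)"
    proof (rule integral_mono)
      show "integrable lborel (\<lambda>x. std_normal_density x * \<bar>x\<bar> powr p - (t - 1) / 2 * (std_normal_density x * \<bar>x\<bar> powr (p + 2)))"
        using assms by (intro Bochner_Integration.integrable_diff integrable_mult_right integrable_gauss_abs_moment) auto
      fix x :: real
      have "1 - (t - 1) / 2 * x\<^sup>2 \<le> exp (- ((t - 1) / 2 * x\<^sup>2))"
        using exp_ge_add_one_self[of "- ((t - 1) / 2 * x\<^sup>2)"] by simp
      then have "std_normal_density x * \<bar>x\<bar> powr p * (1 - (t - 1) / 2 * x\<^sup>2)
         \<le> std_normal_density x * \<bar>x\<bar> powr p * exp (- ((t - 1) / 2 * x\<^sup>2))"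
        by (intro mult_left_mono) auto
      also have "std_normal_density x * \<bar>x\<bar> powr p * exp (- ((t - 1) / 2 * x\<^sup>2))
        = (std_normal_density x * exp (- ((t - 1) / 2 * x\<^sup>2))) * \<bar>x\<bar> powr p" by simp
      also have "std_normal_density x * exp (- ((t - 1) / 2 * x\<^sup>2)) = std_normal_density (c * x)"
        unfolding c(2)[symmetric]
        by (simp add: normal_density_def power_mult_distrib field_simps flip: exp_add)
      finally show "std_normal_density x * \<bar>x\<bar> powr p - (t - 1) / 2 * (std_normal_density x * \<bar>x\<bar> powr (p + 2))
        \<le> std_normal_density (c * x) * \<bar>x\<bar> powr p"
        by (simp add: pw algebra_simps)
    qed (rule int)
    also have "\<dots> = t powr (-r) * gauss_abs_moment p"
    proof -
      have "c powr (-(p+1)) * c powr (p+1) = 1"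
        using c by (simp only: powr_add[symmetric]) simp
      then show ?thesis
        unfolding cr[symmetric] eq by (simp only: mult.assoc[symmetric] mult_1)
    qed
    finally have fin: "gauss_abs_moment p - (t - 1) / 2 * gauss_abs_moment (p + 2) \<le> t powr (-r) * gauss_abs_moment p" .
    have "x * ((1 - s) / (t - 1)) \<le> y / 2" if "x - (t - 1) / 2 * y \<le> s * x" for x y s :: real
    proof -
      have "x * (1 - s) \<le> y / 2 * (t - 1)" using that by (simp add: algebra_simps diff_divide_distrib)
      then have "x * (1 - s) / (t - 1) \<le> y / 2" using \<open>t > 1\<close> by (subst pos_divide_le_eq) auto
      then show ?thesis by simp
    qed
    from this[OF fin] show ?thesis .
  qed
  have "((\<lambda>t. t powr (-r)) has_real_derivative (-r) * 1 powr (-r - 1)) (at 1)"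
    by (rule has_real_derivative_powr) simp
  then have "((\<lambda>t. (t powr (-r) - 1 powr (-r)) / (t - 1)) \<longlongrightarrow> (-r) * 1 powr (-r - 1)) (at 1)"
    by (simp add: has_field_derivative_iff)
  then have "((\<lambda>t. - ((t powr (-r) - 1 powr (-r)) / (t - 1))) \<longlongrightarrow> - ((-r) * 1 powr (-r - 1))) (at_right 1)"
    by (intro tendsto_minus) (simp add: filterlim_at_split)
  then have "((\<lambda>t. (1 - t powr (-r)) / (t - 1)) \<longlongrightarrow> r) (at_right 1)"
    by (simp add: minus_divide_left)
  then have "((\<lambda>t. gauss_abs_moment p * ((1 - t powr (-r)) / (t - 1))) \<longlongrightarrow> gauss_abs_moment p * r) (at_right 1)"
    by (rule tendsto_mult_left)
  moreover have "eventually (\<lambda>t. gauss_abs_moment p * ((1 - t powr (-r)) / (t - 1)) \<le> gauss_abs_moment (p + 2) / 2) (at_right 1)"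
    using eventually_at_right_less[of "1::real"] by eventually_elim (rule scaled)
  ultimately have "gauss_abs_moment p * r \<le> gauss_abs_moment (p + 2) / 2"
    by (rule tendsto_upperbound) simp
  then show ?thesis by (simp add: r_def mult.commute)
qed

section \<open>Raising the exponent by two\<close>
lemma has_real_derivative_abs_powr_nonzero:
  fixes r x :: real assumes "x \<noteq> 0"
  shows "((\<lambda>x. \<bar>x\<bar> powr r) has_real_derivative r * (x * \<bar>x\<bar> powr (r - 2))) (at x)"
proof (cases "x > 0")
  case True
  have "((\<lambda>x. x powr r) has_real_derivative r * x powr (r - 1)) (at x)"
    using True by (rule has_real_derivative_powr)
  then have "((\<lambda>x. \<bar>x\<bar> powr r) has_real_derivative r * x powr (r - 1)) (at x)"
    by (rule has_field_derivative_transform_within_open[where S = "{0<..}"]) (use True in auto)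
  moreover have "x powr (r - 1) = x * \<bar>x\<bar> powr (r - 2)"
    using True powr_add[of x 1 "r - 2"] by simp
  ultimately show ?thesis by simp
next
  case False
  then have less: "x < 0" using assms by simp
  have "((\<lambda>x. (- x) powr r) has_real_derivative r * (- x) powr (r - 1) * (-1)) (at x)"
    by (rule derivative_eq_intros refl | use less in simp)+
  then have "((\<lambda>x. \<bar>x\<bar> powr r) has_real_derivative r * (- x) powr (r - 1) * (-1)) (at x)"
    by (rule has_field_derivative_transform_within_open[where S = "{..<0}"]) (use less in auto)
  moreover have "(- x) powr (r - 1) = (- x) * \<bar>x\<bar> powr (r - 2)"
    using less powr_add[of "- x" 1 "r - 2"] by simp
  ultimately show ?thesis by (simp add: mult_ac)
qed

lemma has_real_derivative_abs_powr:
  fixes r x :: real assumes "1 < r"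
  shows "((\<lambda>x. \<bar>x\<bar> powr r) has_real_derivative r * (x * \<bar>x\<bar> powr (r - 2))) (at x)"
proof (cases "x = 0")
  case True
  have "((\<lambda>h::real. \<bar>h\<bar> powr (r - 1)) \<longlongrightarrow> 0) (at 0)"
    using tendsto_powr'[of "\<lambda>h::real. \<bar>h\<bar>" 0 "at 0" "\<lambda>_. r - 1" "r - 1"] assms
    by (auto intro!: tendsto_eq_intros)
  then have "((\<lambda>h::real. \<bar>h\<bar> powr r / h) \<longlongrightarrow> 0) (at 0)"
  proof (rule Lim_null_comparison[rotated])
    show "eventually (\<lambda>h::real. norm (\<bar>h\<bar> powr r / h) \<le> \<bar>h\<bar> powr (r - 1)) (at 0)"
      by (intro eventuallyI) (auto simp: powr_diff)
  qed
  then show ?thesis using assms True by (simp add: has_field_derivative_iff)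
qed (rule has_real_derivative_abs_powr_nonzero)

lemma has_real_derivative_signed_powr:
  fixes r x :: real assumes "0 < r"
  shows "((\<lambda>x. x * \<bar>x\<bar> powr r) has_real_derivative (r + 1) * \<bar>x\<bar> powr r) (at x)"
proof (cases "x = 0")
  case True
  have "((\<lambda>h::real. \<bar>h\<bar> powr r) \<longlongrightarrow> 0) (at 0)"
    using tendsto_powr'[of "\<lambda>h::real. \<bar>h\<bar>" 0 "at 0" "\<lambda>_. r" r] assms
    by (auto intro!: tendsto_eq_intros)
  then have "((\<lambda>h::real. h * \<bar>h\<bar> powr r / h) \<longlongrightarrow> 0) (at 0)"
    by (rule Lim_transform_eventually) (auto simp: eventually_at_filter)
  then show ?thesis using True assms by (simp add: has_field_derivative_iff)
next
  case False
  then have "((\<lambda>x. x * \<bar>x\<bar> powr r) has_real_derivative 1 * \<bar>x\<bar> powr r + r * (x * \<bar>x\<bar> powr (r - 2)) * x) (at x)"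
    by (intro DERIV_mult DERIV_ident has_real_derivative_abs_powr_nonzero)
  moreover have "x * \<bar>x\<bar> powr (r - 2) * x = \<bar>x\<bar> powr r"
  proof -
    have "\<bar>x\<bar> powr r = \<bar>x\<bar> powr 2 * \<bar>x\<bar> powr (r - 2)"
      by (simp only: powr_add[symmetric]) simp
    also have "\<bar>x\<bar> powr 2 = x * x" using False by (simp add: powr_numeral power2_eq_square)
    finally show ?thesis by (simp add: mult_ac)
  qed
  ultimately show ?thesis by (simp add: algebra_simps)
qed

lemma mono_signed_powr:
  fixes r :: real assumes "0 \<le> r" "x \<le> y"
  shows "x * \<bar>x\<bar> powr r \<le> y * \<bar>y\<bar> powr r"
proof (cases "0 \<le> x")
  case True
  then show ?thesis using assms by (intro mult_mono powr_mono2) auto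
next
  case False
  show ?thesis
  proof (cases "0 \<le> y")
    case True
    have "x * \<bar>x\<bar> powr r \<le> 0" using False by (simp add: mult_nonpos_nonneg)
    also have "0 \<le> y * \<bar>y\<bar> powr r" using True by simp
    finally show ?thesis .
  next
    case neg: False
    have "(- y) * \<bar>y\<bar> powr r \<le> (- x) * \<bar>x\<bar> powr r"
      using assms neg by (intro mult_mono powr_mono2) auto
    then show ?thesis by simp
  qed
qed

text \<open>Simpson's rule overestimates the integral of $(p+1)|x|^p$ over $[y-a,y+a]$, because the
third derivative of $|x|^p$ is nondecreasing for $p \ge 4$. The error is integrated up from zero by
differentiating three times in $a$.\<close>
lemma simpson_abs_powr:
  fixes y a p :: real
  assumes "4 \<le> p" "0 \<le> a"
  shows "(y + a) * \<bar>y + a\<bar> powr p - (y - a) * \<bar>y - a\<bar> powr p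
    \<le> (p + 1) * a / 3 * (\<bar>y + a\<bar> powr p + 4 * \<bar>y\<bar> powr p + \<bar>y - a\<bar> powr p)"
proof -
  define k0 where "k0 x = \<bar>x\<bar> powr p" for x :: real
  define k1 where "k1 x = p * (x * \<bar>x\<bar> powr (p - 2))" for x :: real
  define k2 where "k2 x = p * ((p - 1) * \<bar>x\<bar> powr (p - 2))" for x :: real
  define k3 where "k3 x = p * ((p - 1) * ((p - 2) * (x * \<bar>x\<bar> powr (p - 4))))" for x :: real
  define h where "h x = x * \<bar>x\<bar> powr p" for x :: real
  define c where "c = (p + 1) / 3"
  have c: "0 \<le> c" "p + 1 = 3 * c" using assms by (simp_all add: c_def)
  have d_h: "(h has_real_derivative 3 * c * k0 x) (at x)" for x
    unfolding h_def k0_def c(2)[symmetric] using has_real_derivative_signed_powr[of p x] assms by simp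
  have d0: "(k0 has_real_derivative k1 x) (at x)" for x
    unfolding k1_def k0_def using has_real_derivative_abs_powr[of p x] assms by simp
  have d1: "(k1 has_real_derivative k2 x) (at x)" for x
    unfolding k1_def k2_def using DERIV_cmult[OF has_real_derivative_signed_powr[of "p - 2" x], of p] assms by simp
  have d2: "(k2 has_real_derivative k3 x) (at x)" for x
    unfolding k2_def k3_def
    using DERIV_cmult[OF DERIV_cmult[OF has_real_derivative_abs_powr[of "p - 2" x], of "p - 1"], of p] assms by simp
  note shifted = DERIV_chain2[OF d_h] DERIV_chain2[OF d0] DERIV_chain2[OF d1] DERIV_chain2[OF d2]
  define F3 where "F3 t = t * (k2 (y + t) + k2 (y - t)) - (k1 (y + t) - k1 (y - t))" for t
  define F2 where "F2 t = 4 * k0 y - 2 * (k0 (y + t) + k0 (y - t)) + t * (k1 (y + t) - k1 (y - t))" for t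
  define F1 where "F1 t = c * t * (k0 (y + t) + 4 * k0 y + k0 (y - t)) - (h (y + t) - h (y - t))" for t
  have dF3: "(F3 has_real_derivative t * (k3 (y + t) - k3 (y - t))) (at t)" for t
    unfolding F3_def by (auto intro!: derivative_eq_intros shifted simp: algebra_simps)
  have dF2: "(F2 has_real_derivative F3 t) (at t)" for t
    unfolding F2_def F3_def by (auto intro!: derivative_eq_intros shifted simp: algebra_simps)
  have dF1: "(F1 has_real_derivative c * F2 t) (at t)" for t
    unfolding F1_def F2_def by (auto intro!: derivative_eq_intros shifted simp: algebra_simps)
  have "0 \<le> t * (k3 (y + t) - k3 (y - t))" if "0 \<le> t" for t
  proof -
    have "k3 (y - t) \<le> k3 (y + t)"
      unfolding k3_def using assms that by (intro mult_left_mono mono_signed_powr) auto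
    then show ?thesis using that by simp
  qed
  then have "F3 0 \<le> F3 t" if "0 \<le> t" for t
    using that dF3 by (intro DERIV_nonneg_imp_nondecreasing[of 0 t F3]) blast+
  then have "0 \<le> F3 t" if "0 \<le> t" for t using that by (simp add: F3_def)
  then have "F2 0 \<le> F2 t" if "0 \<le> t" for t
    using that dF2 by (intro DERIV_nonneg_imp_nondecreasing[of 0 t F2]) blast+
  then have "0 \<le> F2 t" if "0 \<le> t" for t using that by (simp add: F2_def)
  then have "0 \<le> c * F2 t" if "0 \<le> t" for t
    using that c by (intro mult_nonneg_nonneg) auto
  then have "F1 0 \<le> F1 a"
    using assms(2) dF1 by (intro DERIV_nonneg_imp_nondecreasing[of 0 a F1]) blast+
  then show ?thesis by (simp add: F1_def h_def k0_def c_def)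
qed

text \<open>After multiplication by $a$ both sides are even in $a$, so the sign of $a$ does not matter.\<close>
lemma simpson_abs_powr':
  fixes y a p :: real
  assumes "4 \<le> p"
  shows "a * ((y + a) * \<bar>y + a\<bar> powr p - (y - a) * \<bar>y - a\<bar> powr p)
    \<le> (p + 1) * a\<^sup>2 / 3 * (\<bar>y + a\<bar> powr p + 4 * \<bar>y\<bar> powr p + \<bar>y - a\<bar> powr p)"
proof (cases "0 \<le> a")
  case True
  then show ?thesis
    using mult_left_mono[OF simpson_abs_powr[OF assms True, of y], of a] by (simp add: power2_eq_square mult_ac)
next
  case False
  then show ?thesis
    using mult_left_mono[OF simpson_abs_powr[OF assms, of "- a" y], of "- a"] by (simp add: power2_eq_square algebra_simps)
qed

text \<open>This is $E[S\,h(S)] = \sum_i a_i\,E[\varepsilon_i h(S)]$ with the expectation over $\varepsilon_i$ carried out.\<close>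
lemma sign_mean_times_self:
  assumes "finite I"
  shows "sign_mean I a (\<lambda>s. s * h s)
    = (\<Sum>i\<in>I. a i / 2 * (sign_mean (I - {i}) a (\<lambda>s. h (s + a i)) - sign_mean (I - {i}) a (\<lambda>s. h (s - a i))))"
  using assms
proof (induction I arbitrary: h)
  case (insert j I)
  let ?D = "\<lambda>J h i. sign_mean J a (\<lambda>s. h (s + a i)) - sign_mean J a (\<lambda>s. h (s - a i))"
  have "sign_mean (insert j I) a (\<lambda>s. s * h s)
     = (sign_mean I a (\<lambda>s. s * h (s + a j) + a j * h (s + a j)) + sign_mean I a (\<lambda>s. s * h (s - a j) - a j * h (s - a j))) / 2"
    unfolding sign_mean_insert[OF insert(1,2)] by (simp add: algebra_simps)
  also have "\<dots> = (sign_mean I a (\<lambda>s. s * h (s + a j)) + sign_mean I a (\<lambda>s. s * h (s - a j))) / 2 + a j / 2 * ?D I h j"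
    by (simp add: sign_mean_add sign_mean_diff sign_mean_cmult field_simps)
  also have "(sign_mean I a (\<lambda>s. s * h (s + a j)) + sign_mean I a (\<lambda>s. s * h (s - a j))) / 2
     = (\<Sum>i\<in>I. a i / 2 * ((?D (I - {i}) (\<lambda>s. h (s + a j)) i + ?D (I - {i}) (\<lambda>s. h (s - a j)) i) / 2))"
    unfolding insert.IH by (simp add: sum.distrib[symmetric] sum_divide_distrib algebra_simps add_divide_distrib diff_divide_distrib)
  also have "\<dots> = (\<Sum>i\<in>I. a i / 2 * ?D (insert j I - {i}) h i)"
  proof (rule sum.cong)
    fix i assume i: "i \<in> I"
    have eq: "insert j I - {i} = insert j (I - {i})" and fin: "finite (I - {i})" "j \<notin> I - {i}"
      using insert i by auto
    show "a i / 2 * ((?D (I - {i}) (\<lambda>s. h (s + a j)) i + ?D (I - {i}) (\<lambda>s. h (s - a j)) i) / 2)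
       = a i / 2 * ?D (insert j I - {i}) h i"
      unfolding eq sign_mean_insert[OF fin] by (simp add: algebra_simps add_divide_distrib diff_divide_distrib)
  qed simp
  finally show ?case using insert(1,2) by (simp add: Diff_insert_absorb)
qed simp

text \<open>Writing $|S|^{p+2} = S\cdot S|S|^p$ reduces the moment to differences of $s|s|^p$, to which Simpson's rule
applies. The end points of the interval give back the moment of $S$ and the midpoint gives
the moment of $S$ without its $i$-th summand.\<close>
lemma sign_mean_powr_add_2:
  fixes a :: "'i \<Rightarrow> real"
  assumes "finite I" "4 \<le> p"
  shows "sign_mean I a (\<lambda>s. \<bar>s\<bar> powr (p + 2))
    \<le> (p + 1) * (\<Sum>i\<in>I. (a i)\<^sup>2 * (sign_mean I a (\<lambda>s. \<bar>s\<bar> powr p) / 3 + 2 / 3 * sign_mean (I - {i}) a (\<lambda>s. \<bar>s\<bar> powr p)))"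
proof -
  define h where "h s = s * \<bar>s\<bar> powr p" for s :: real
  have "\<bar>s\<bar> powr (p + 2) = s * h s" for s :: real
    by (cases "s = 0") (simp_all add: h_def powr_add powr_numeral power2_eq_square mult_ac)
  then have "sign_mean I a (\<lambda>s. \<bar>s\<bar> powr (p + 2))
     = (\<Sum>i\<in>I. a i / 2 * (sign_mean (I - {i}) a (\<lambda>s. h (s + a i)) - sign_mean (I - {i}) a (\<lambda>s. h (s - a i))))"
    using sign_mean_times_self[OF assms(1), of a h] by simp
  also have "\<dots> \<le> (\<Sum>i\<in>I. (p + 1) * ((a i)\<^sup>2 * (sign_mean I a (\<lambda>s. \<bar>s\<bar> powr p) / 3 + 2 / 3 * sign_mean (I - {i}) a (\<lambda>s. \<bar>s\<bar> powr p))))"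
  proof (rule sum_mono)
    fix i assume i: "i \<in> I"
    let ?m = "sign_mean (I - {i}) a"
    have I: "I = insert i (I - {i})" using i by auto
    have eq: "sign_mean I a (\<lambda>s. \<bar>s\<bar> powr p) = (?m (\<lambda>s. \<bar>s + a i\<bar> powr p) + ?m (\<lambda>s. \<bar>s - a i\<bar> powr p)) / 2"
      by (subst I, subst sign_mean_insert) (use assms(1) in auto)
    have "a i * (?m (\<lambda>s. h (s + a i)) - ?m (\<lambda>s. h (s - a i))) = ?m (\<lambda>s. a i * (h (s + a i) - h (s - a i)))"
      by (simp add: sign_mean_cmult sign_mean_diff)
    also have "\<dots> \<le> ?m (\<lambda>s. (p + 1) * (a i)\<^sup>2 / 3 * (\<bar>s + a i\<bar> powr p + 4 * \<bar>s\<bar> powr p + \<bar>s - a i\<bar> powr p))"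
      unfolding h_def by (intro sign_mean_mono simpson_abs_powr' assms)
    also have "\<dots> = (p + 1) * (a i)\<^sup>2 / 3 * (?m (\<lambda>s. \<bar>s + a i\<bar> powr p) + 4 * ?m (\<lambda>s. \<bar>s\<bar> powr p) + ?m (\<lambda>s. \<bar>s - a i\<bar> powr p))"
      by (simp only: sign_mean_cmult sign_mean_add)
    finally show "a i / 2 * (?m (\<lambda>s. h (s + a i)) - ?m (\<lambda>s. h (s - a i)))
       \<le> (p + 1) * ((a i)\<^sup>2 * (sign_mean I a (\<lambda>s. \<bar>s\<bar> powr p) / 3 + 2 / 3 * ?m (\<lambda>s. \<bar>s\<bar> powr p)))"
      unfolding eq by (simp add: field_simps)
  qed
  finally show ?thesis by (simp add: sum_distrib_left)
qed

section \<open>The moment bound for all exponents\<close>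

text \<open>The bound is quantified over all unit vectors because passing from $p$ to $p+2$ uses it for the
vector with one coordinate deleted.\<close>
definition khinchine_bound :: "real \<Rightarrow> bool" where
  "khinchine_bound p \<longleftrightarrow> (\<forall>(I :: nat set) a. finite I \<longrightarrow> (\<Sum>i\<in>I. (a i)\<^sup>2) = 1 \<longrightarrow>
     sign_mean I a (\<lambda>s. \<bar>s\<bar> powr p) \<le> (1 - (\<Sum>i\<in>I. (a i)^4) / 6) powr p * gauss_abs_moment p)"

lemma khinchine_boundD:
  "khinchine_bound p \<Longrightarrow> finite I \<Longrightarrow> (\<Sum>i\<in>I. (a i)\<^sup>2) = 1 \<Longrightarrow>
    sign_mean I a (\<lambda>s. \<bar>s\<bar> powr p) \<le> (1 - (\<Sum>i\<in>I. (a i)^4) / 6) powr p * gauss_abs_moment p"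
  for I :: "nat set"
  by (simp add: khinchine_bound_def)

text \<open>At $p = 4$ the constant of \<open>nn_integral_cos_remainder\<close> is infinite, but $E S^4 = 3 - 2x$ is explicit
and the claim is Bernoulli's inequality.\<close>
lemma khinchine_bound_4: "khinchine_bound 4"
  unfolding khinchine_bound_def
proof (intro allI impI)
  fix I :: "nat set" and a :: "nat \<Rightarrow> real"
  assume fin: "finite I" and one: "(\<Sum>i\<in>I. (a i)\<^sup>2) = 1"
  define x where "x = (\<Sum>i\<in>I. (a i)^4)"
  have x: "x \<le> 1" using sum_fourth_le_one[OF fin one] by (simp add: x_def)
  have "\<bar>s\<bar> powr 4 = (0 + s)^4" for s :: real by (cases "s = 0") (simp_all add: powr_numeral)
  then have "sign_mean I a (\<lambda>s. \<bar>s\<bar> powr 4) = 3 - 2 * x"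
    using sign_mean_fourth_power[OF fin, of a 0] one by (simp add: x_def)
  also have "\<dots> = (1 + real 4 * (- (x/6))) * 3" by simp
  also have "\<dots> \<le> (1 + - (x/6))^4 * 3"
    using x by (intro mult_right_mono Bernoulli_inequality) auto
  also have "\<dots> = (1 - x/6) powr 4 * gauss_abs_moment 4"
    using x by (simp add: gauss_abs_moment_4 powr_numeral)
  finally show "sign_mean I a (\<lambda>s. \<bar>s\<bar> powr 4) \<le> (1 - (\<Sum>i\<in>I. (a i)^4) / 6) powr 4 * gauss_abs_moment 4"
    by (simp add: x_def)
qed

lemma khinchine_bound_between:
  assumes "4 < p" "p < 6"
  shows "khinchine_bound p"
  unfolding khinchine_bound_def
proof (intro allI impI)
  fix I :: "nat set" and a :: "nat \<Rightarrow> real"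
  assume fin: "finite I" and one: "(\<Sum>i\<in>I. (a i)\<^sup>2) = 1"
  let ?x = "\<Sum>i\<in>I. (a i)^4"
  have "0 \<le> 1 - ?x / 6" using sum_fourth_le_one[OF fin one] by simp
  then have "ennreal (sign_mean I a (\<lambda>s. \<bar>s\<bar> powr p)) \<le> ennreal ((1 - ?x/6) powr p * gauss_abs_moment p)"
    using sign_mean_powr_le_nn_integral[OF fin one assms] nn_integral_gauss_abs_moment[of p "1 - ?x/6"] assms by simp
  then show "sign_mean I a (\<lambda>s. \<bar>s\<bar> powr p) \<le> (1 - ?x/6) powr p * gauss_abs_moment p"
    by (subst (asm) ennreal_le_iff) (simp_all add: gauss_abs_moment_nonneg)
qed

lemma khinchine_bound_scaled:
  fixes I :: "nat set" and a :: "nat \<Rightarrow> real"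
  assumes "khinchine_bound p" "finite I" "0 < p"
  defines "t \<equiv> \<Sum>i\<in>I. (a i)\<^sup>2"
  assumes "0 < t"
  shows "sign_mean I a (\<lambda>s. \<bar>s\<bar> powr p)
    \<le> (sqrt t * (1 - (\<Sum>i\<in>I. (a i)^4) / (6 * t\<^sup>2))) powr p * gauss_abs_moment p"
proof -
  define b where "b i = a i / sqrt t" for i
  have a: "a = (\<lambda>i. sqrt t * b i)" using assms by (simp add: b_def fun_eq_iff)
  have b2: "(\<Sum>i\<in>I. (b i)\<^sup>2) = 1"
    using assms(5) by (simp add: b_def power_divide t_def flip: sum_divide_distrib)
  have "(\<Sum>i\<in>I. (b i)^4) = (\<Sum>i\<in>I. (a i)^4) / (sqrt t)^4"
    by (simp add: b_def power_divide sum_divide_distrib)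
  also have "(sqrt t)^4 = ((sqrt t)\<^sup>2)\<^sup>2" by (simp flip: power_mult)
  finally have b4: "(\<Sum>i\<in>I. (b i)^4) = (\<Sum>i\<in>I. (a i)^4) / t\<^sup>2"
    using assms(5) by simp
  have "sign_mean I a (\<lambda>s. \<bar>s\<bar> powr p) = sign_mean I b (\<lambda>s. (sqrt t) powr p * \<bar>s\<bar> powr p)"
    using assms(5) by (subst a) (simp add: sign_mean_scale abs_mult powr_mult)
  also have "\<dots> \<le> (sqrt t) powr p * ((1 - (\<Sum>i\<in>I. (b i)^4) / 6) powr p * gauss_abs_moment p)"
    unfolding sign_mean_cmult using khinchine_boundD[OF assms(1,2) b2] by (intro mult_left_mono) auto
  also have "\<dots> = (sqrt t * (1 - (\<Sum>i\<in>I. (b i)^4) / 6)) powr p * gauss_abs_moment p"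
    using assms(5) sum_fourth_le_one[OF assms(2) b2] by (simp add: powr_mult)
  finally show ?thesis unfolding b4 by (simp add: mult.commute)
qed

text \<open>Deleting a coordinate of square $s$ from a unit vector leaves a vector of norm
$\sqrt{1-s}$, whose bound, rescaled by this norm, is at most $1 - s/3$ times the bound $1 - x/6$
for the full vector. For $p \ge 4$ the $p$-th power of $1 - s/3$ is at most $1 - s/2$.\<close>
lemma deletion_bound:
  fixes s x p :: real
  assumes "0 \<le> s" "s < 1" "s\<^sup>2 \<le> x" "x \<le> 1" "x - s\<^sup>2 \<le> (1 - s)\<^sup>2" "4 \<le> p"
  shows "(sqrt (1 - s) * (1 - (x - s\<^sup>2) / (6 * (1 - s)\<^sup>2))) powr p \<le> (1 - x/6) powr p * (1 - s/2)"
proof -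
  define t where "t = 1 - s"
  have t: "0 < t" "t \<le> 1" using assms by (auto simp: t_def)
  have "sqrt t \<le> 1 - s/2"
  proof (rule real_le_lsqrt)
    show "t \<le> (1 - s/2)\<^sup>2" by (simp add: t_def power2_eq_square algebra_simps)
  qed (use assms in auto)
  have "t\<^sup>2 \<le> sqrt t"
  proof -
    have "t\<^sup>2 \<le> t" using t by (simp add: power2_eq_square mult_left_le)
    also have "t \<le> sqrt t" using t by (intro real_le_rsqrt) (simp add: power2_eq_square mult_left_le)
    finally show ?thesis .
  qed
  then have "(x - s\<^sup>2) / 6 * 1 \<le> (x - s\<^sup>2) / 6 * (sqrt t / t\<^sup>2)"
    using assms t by (intro mult_left_mono) auto
  then have "sqrt t * (1 - (x - s\<^sup>2) / (6 * t\<^sup>2)) \<le> sqrt t - (x - s\<^sup>2) / 6"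
    by (simp add: algebra_simps)
  also have "\<dots> \<le> 1 - s/2 - (x - s\<^sup>2) / 6" using \<open>sqrt t \<le> 1 - s/2\<close> by simp
  also have "\<dots> \<le> (1 - x/6) * (1 - s/3)"
  proof -
    have "0 \<le> x" using order_trans[OF zero_le_power2 assms(3)] .
    then have "0 \<le> s * (1 - s)" "0 \<le> x * s" using assms by simp_all
    then show ?thesis by (simp add: field_simps power2_eq_square)
  qed
  finally have le: "sqrt t * (1 - (x - s\<^sup>2) / (6 * t\<^sup>2)) \<le> (1 - x/6) * (1 - s/3)" .
  have "0 \<le> sqrt t * (1 - (x - s\<^sup>2) / (6 * t\<^sup>2))"
  proof (intro mult_nonneg_nonneg)
    have "x - s\<^sup>2 \<le> 6 * t\<^sup>2" using assms(5) zero_le_power2[of t] unfolding t_def[symmetric] by linarith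
    then show "0 \<le> 1 - (x - s\<^sup>2) / (6 * t\<^sup>2)" using t by simp
  qed (use t in auto)
  then have "(sqrt t * (1 - (x - s\<^sup>2) / (6 * t\<^sup>2))) powr p \<le> ((1 - x/6) * (1 - s/3)) powr p"
    using le assms by (intro powr_mono2) auto
  also have "\<dots> = (1 - x/6) powr p * (1 - s/3) powr p"
    by (rule powr_mult)
  also have "\<dots> \<le> (1 - x/6) powr p * (1 - s/2)"
  proof (rule mult_left_mono)
    have "(1 - s/3) powr p \<le> (1 - s/3) powr 2" using assms by (intro powr_mono') auto
    also have "\<dots> = (1 - s/3)\<^sup>2" using assms by (simp add: powr_numeral)
    also have "\<dots> \<le> 1 - s/2"
    proof -
      have "0 \<le> s * (1 - s)" using assms by simp
      then show ?thesis using assms by (simp add: field_simps power2_eq_square)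
    qed
    finally show "(1 - s/3) powr p \<le> 1 - s/2" .
  qed simp
  finally show ?thesis by (simp add: t_def)
qed

text \<open>Inserting the bounds for $S$ and for $S$ with a deleted summand into \<open>sign_mean_powr_add_2\<close> gives the
factor $\sum_i a_i^2\,(\frac13 + \frac23(1 - \frac{a_i^2}{2})) = 1 - \frac x3 \le (1 - \frac x6)^2$, which is
what the two additional powers of $1 - x/6$ demand.\<close>
lemma khinchine_bound_add_2:
  assumes "khinchine_bound p" "4 \<le> p"
  shows "khinchine_bound (p + 2)"
  unfolding khinchine_bound_def
proof (intro allI impI)
  fix I :: "nat set" and a :: "nat \<Rightarrow> real"
  assume fin: "finite I" and one: "(\<Sum>i\<in>I. (a i)\<^sup>2) = 1"
  define x where "x = (\<Sum>i\<in>I. (a i)^4)"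
  have x: "x \<le> 1" using sum_fourth_le_one[OF fin one] by (simp add: x_def)
  define B where "B = (1 - x/6) powr p * gauss_abs_moment p"
  have B: "0 \<le> B" by (simp add: B_def gauss_abs_moment_nonneg)
  have full: "sign_mean I a (\<lambda>s. \<bar>s\<bar> powr p) \<le> B"
    using khinchine_boundD[OF assms(1) fin one] by (simp add: B_def x_def)
  have deleted: "sign_mean (I - {i}) a (\<lambda>s. \<bar>s\<bar> powr p) \<le> B * (1 - (a i)\<^sup>2 / 2)" if i: "i \<in> I" for i
  proof -
    define s where "s = (a i)\<^sup>2"
    have s2: "(a i)^4 = s\<^sup>2" by (simp add: s_def flip: power_mult)
    have rest: "(\<Sum>j\<in>I - {i}. (a j)\<^sup>2) = 1 - s" "(\<Sum>j\<in>I - {i}. (a j)^4) = x - s\<^sup>2"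
      using sum.remove[OF fin i, of "\<lambda>j. (a j)\<^sup>2"] sum.remove[OF fin i, of "\<lambda>j. (a j)^4"] one
      by (simp_all add: s_def x_def flip: power_mult)
    have "0 \<le> s" by (simp add: s_def)
    have "0 \<le> 1 - s" unfolding rest(1)[symmetric] by (intro sum_nonneg) auto
    show ?thesis
    proof (cases "s = 1")
      case True
      then have "a j = 0" if "j \<in> I - {i}" for j
        using rest(1) that fin by (simp add: sum_nonneg_eq_0_iff)
      then have "sign_mean (I - {i}) a (\<lambda>s. \<bar>s\<bar> powr p) = sign_mean (I - {i}) (\<lambda>j. 0 * a j) (\<lambda>s. \<bar>s\<bar> powr p)"
        unfolding sign_mean_def by (intro arg_cong2[where f = "(/)"] sum.cong refl) (auto intro!: arg_cong2[where f = "(-)"] simp: subset_iff)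
      also have "\<dots> = 0" unfolding sign_mean_scale using fin by simp
      finally show ?thesis using B True by (simp add: s_def[symmetric])
    next
      case False
      then have s: "s < 1" using \<open>0 \<le> 1 - s\<close> by simp
      have x': "0 \<le> x - s\<^sup>2" unfolding rest(2)[symmetric] by (intro sum_nonneg) auto
      have x'': "x - s\<^sup>2 \<le> (1 - s)\<^sup>2"
      proof -
        have "x - s\<^sup>2 = (\<Sum>j\<in>I - {i}. (a j)\<^sup>2 * (a j)\<^sup>2)" unfolding rest(2)[symmetric] by (simp flip: power_add)
        also have "\<dots> \<le> (\<Sum>j\<in>I - {i}. (a j)\<^sup>2 * (1 - s))"
          unfolding rest(1)[symmetric] using fin by (intro sum_mono mult_left_mono member_le_sum) auto
        finally have "x - s\<^sup>2 \<le> (\<Sum>j\<in>I - {i}. (a j)\<^sup>2) * (1 - s)" by (simp only: sum_distrib_right)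
        then show ?thesis unfolding rest(1) by (simp only: power2_eq_square)
      qed
      have "sign_mean (I - {i}) a (\<lambda>s. \<bar>s\<bar> powr p)
        \<le> (sqrt (1 - s) * (1 - (x - s\<^sup>2) / (6 * (1 - s)\<^sup>2))) powr p * gauss_abs_moment p"
        using khinchine_bound_scaled[OF assms(1), of "I - {i}" a] fin assms(2) s unfolding rest by simp
      also have "\<dots> \<le> ((1 - x/6) powr p * (1 - s/2)) * gauss_abs_moment p"
        using deletion_bound[of s x p] \<open>0 \<le> s\<close> s x x' x'' assms(2)
        by (intro mult_right_mono) (auto simp: gauss_abs_moment_nonneg)
      finally show ?thesis by (simp add: B_def s_def mult_ac)
    qed
  qed
  have "sign_mean I a (\<lambda>s. \<bar>s\<bar> powr (p + 2))
    \<le> (p + 1) * (\<Sum>i\<in>I. (a i)\<^sup>2 * (sign_mean I a (\<lambda>s. \<bar>s\<bar> powr p) / 3 + 2 / 3 * sign_mean (I - {i}) a (\<lambda>s. \<bar>s\<bar> powr p)))"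
    by (rule sign_mean_powr_add_2[OF fin assms(2)])
  also have "\<dots> \<le> (p + 1) * (\<Sum>i\<in>I. (a i)\<^sup>2 * (B / 3 + 2 / 3 * (B * (1 - (a i)\<^sup>2 / 2))))"
    using assms(2) full deleted by (intro mult_left_mono sum_mono add_mono) auto
  also have "(\<Sum>i\<in>I. (a i)\<^sup>2 * (B / 3 + 2 / 3 * (B * (1 - (a i)\<^sup>2 / 2)))) = B * (1 - x/3)"
  proof -
    have "(a i)\<^sup>2 * (B / 3 + 2 / 3 * (B * (1 - (a i)\<^sup>2 / 2))) = B * (a i)\<^sup>2 - B / 3 * (a i)^4" for i
      by (simp add: field_simps power2_eq_square power4_eq_xxxx)
    then have "(\<Sum>i\<in>I. (a i)\<^sup>2 * (B / 3 + 2 / 3 * (B * (1 - (a i)\<^sup>2 / 2))))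
        = B * (\<Sum>i\<in>I. (a i)\<^sup>2) - B / 3 * x"
      by (simp only: sum_subtractf sum_distrib_left x_def)
    then show ?thesis unfolding one by (simp add: algebra_simps)
  qed
  also have "(p + 1) * (B * (1 - x/3)) \<le> (p + 1) * (B * (1 - x/6)\<^sup>2)"
    using assms(2) B by (intro mult_left_mono) (auto simp: power2_eq_square field_simps)
  also have "\<dots> = (1 - x/6) powr (p + 2) * ((p + 1) * gauss_abs_moment p)"
    using x by (simp add: B_def powr_add powr_numeral)
  also have "\<dots> \<le> (1 - x/6) powr (p + 2) * gauss_abs_moment (p + 2)"
    using assms(2) by (intro mult_left_mono gauss_abs_moment_add_2) auto
  finally show "sign_mean I a (\<lambda>s. \<bar>s\<bar> powr (p + 2)) \<le> (1 - (\<Sum>i\<in>I. (a i)^4) / 6) powr (p + 2) * gauss_abs_moment (p + 2)"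
    by (simp add: x_def)
qed

lemma khinchine_bound:
  assumes "4 \<le> p" shows "khinchine_bound p"
proof -
  have "4 \<le> p \<Longrightarrow> p < 6 + 2 * real k \<Longrightarrow> khinchine_bound p" for k p
  proof (induction k arbitrary: p)
    case 0
    then show ?case using khinchine_bound_4 khinchine_bound_between by (cases "p = 4") auto
  next
    case (Suc k)
    show ?case
    proof (cases "p < 6")
      case True
      then show ?thesis using Suc.IH Suc.prems by simp
    next
      case False
      then have "khinchine_bound (p - 2)" using Suc by simp
      then show ?thesis using khinchine_bound_add_2[of "p - 2"] False by simp
    qed
  qed
  moreover obtain k :: nat where "p < real k" using reals_Archimedean2 by blast
  then have "p < 6 + 2 * real k" by linarith
  ultimately show ?thesis using assms by blast
qed

section \<open>Rademacher sums and the stability estimate\<close>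
lemma (in prob_space) AE_rademacher:
  assumes "rademacher M X"
  shows "AE \<omega> in M. X \<omega> = 1 \<or> X \<omega> = -1"
proof -
  have [measurable]: "X \<in> borel_measurable M" using assms by (simp add: rademacher_def)
  have "prob ({\<omega> \<in> space M. X \<omega> = 1} \<union> {\<omega> \<in> space M. X \<omega> = -1})
    = prob {\<omega> \<in> space M. X \<omega> = 1} + prob {\<omega> \<in> space M. X \<omega> = -1}"
    by (rule finite_measure_Union) auto
  also have "\<dots> = 1" using assms by (simp add: rademacher_def)
  finally have "prob ({\<omega> \<in> space M. X \<omega> = 1} \<union> {\<omega> \<in> space M. X \<omega> = -1}) = 1" .
  then have "AE \<omega> in M. \<omega> \<in> {\<omega> \<in> space M. X \<omega> = 1} \<union> {\<omega> \<in> space M. X \<omega> = -1}"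
    by (rule AE_prob_1)
  then show ?thesis by eventually_elim auto
qed

lemma (in prob_space) nn_integral_rademacher:
  assumes "rademacher M X" and [measurable]: "f \<in> borel_measurable borel"
  shows "(\<integral>\<^sup>+\<omega>. f (X \<omega>) \<partial>M) = (f 1 + f (-1)) / 2"
proof -
  have [measurable]: "X \<in> borel_measurable M" using assms by (simp add: rademacher_def)
  let ?A = "\<lambda>c. {\<omega> \<in> space M. X \<omega> = c}"
  have "ennreal (1/2) = 1/2" using ennreal_divide_numeral[of 1 "num.Bit0 num.One"] by simp
  then have em: "emeasure M (?A 1) = 1/2" "emeasure M (?A (-1)) = 1/2"
    using assms(1) unfolding rademacher_def emeasure_eq_measure by metis+
  have "(\<integral>\<^sup>+\<omega>. f (X \<omega>) \<partial>M) = (\<integral>\<^sup>+\<omega>. f 1 * indicator (?A 1) \<omega> + f (-1) * indicator (?A (-1)) \<omega> \<partial>M)"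
  proof (rule nn_integral_cong_AE)
    show "AE \<omega> in M. f (X \<omega>) = f 1 * indicator (?A 1) \<omega> + f (-1) * indicator (?A (-1)) \<omega>"
      using AE_rademacher[OF assms(1)] AE_space by eventually_elim (auto simp: indicator_def)
  qed
  also have "\<dots> = f 1 * (1/2) + f (-1) * (1/2)"
    by (subst nn_integral_add) (auto simp: nn_integral_cmult_indicator em)
  also have "\<dots> = (f 1 + f (-1)) / 2"
    by (simp add: divide_ennreal_def distrib_right)
  finally show ?thesis .
qed

lemma (in prob_space) nn_integral_rademacher_sum:
  fixes \<epsilon> :: "'i \<Rightarrow> 'a \<Rightarrow> real" and f :: "real \<Rightarrow> real"
  assumes "finite I" "indep_vars (\<lambda>_. borel) \<epsilon> I" "\<And>i. i \<in> I \<Longrightarrow> rademacher M (\<epsilon> i)"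
    and "f \<in> borel_measurable borel" "\<And>x. 0 \<le> f x"
  shows "(\<integral>\<^sup>+\<omega>. ennreal (f (\<Sum>i\<in>I. a i * \<epsilon> i \<omega>)) \<partial>M) = ennreal (sign_mean I a f)"
  using assms
proof (induction I arbitrary: f)
  case empty
  then show ?case by (simp add: emeasure_space_1)
next
  case (insert j I)
  note [measurable] = insert.prems(3)
  have [measurable]: "\<epsilon> i \<in> borel_measurable M" if "i \<in> insert j I" for i
    using insert.prems(2)[OF that] by (simp add: rademacher_def)
  define Y where "Y \<omega> = (\<Sum>i\<in>I. a i * \<epsilon> i \<omega>)" for \<omega>
  have Y [measurable]: "Y \<in> borel_measurable M" unfolding Y_def by (intro borel_measurable_sum) simp
  have X [measurable]: "\<epsilon> j \<in> borel_measurable M" by simp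
  have IH: "(\<integral>\<^sup>+\<omega>. ennreal (g (Y \<omega>)) \<partial>M) = ennreal (sign_mean I a g)"
    if "g \<in> borel_measurable borel" "\<And>x. 0 \<le> g x" for g
    unfolding Y_def using insert.prems that
    by (intro insert.IH) (auto intro: indep_vars_subset)
  \<comment> \<open>Only the summands over \<open>I\<close> carry their coefficients here, so that the sign itself is independent
     of their sum.\<close>
  have "indep_vars (\<lambda>_. borel) (\<lambda>i \<omega>. (if i = j then 1 else a i) * \<epsilon> i \<omega>) (insert j I)"
    by (rule indep_vars_compose2[OF insert.prems(1)]) simp
  from indep_vars_sum[OF insert.hyps this]
  have "indep_var borel (\<lambda>\<omega>. (if j = j then 1 else a j) * \<epsilon> j \<omega>) borel (\<lambda>\<omega>. \<Sum>i\<in>I. (if i = j then 1 else a i) * \<epsilon> i \<omega>)" .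
  also have "(\<lambda>\<omega>. (if j = j then 1 else a j) * \<epsilon> j \<omega>) = \<epsilon> j" by simp
  also have "(\<lambda>\<omega>. \<Sum>i\<in>I. (if i = j then 1 else a i) * \<epsilon> i \<omega>) = Y"
    unfolding Y_def using insert.hyps by (intro ext sum.cong) auto
  finally have ind: "distr M borel (\<epsilon> j) \<Otimes>\<^sub>M distr M borel Y = distr M (borel \<Otimes>\<^sub>M borel) (\<lambda>\<omega>. (\<epsilon> j \<omega>, Y \<omega>))"
    by (simp add: indep_var_distribution_eq)
  interpret Y: prob_space "distr M borel Y" by (rule prob_space_distr) simp
  have "(\<integral>\<^sup>+\<omega>. ennreal (f (\<Sum>i\<in>insert j I. a i * \<epsilon> i \<omega>)) \<partial>M) = (\<integral>\<^sup>+\<omega>. ennreal (f (a j * \<epsilon> j \<omega> + Y \<omega>)) \<partial>M)"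
    using insert.hyps by (simp add: Y_def)
  also have "\<dots> = (\<integral>\<^sup>+z. ennreal (f (a j * fst z + snd z)) \<partial>distr M (borel \<Otimes>\<^sub>M borel) (\<lambda>\<omega>. (\<epsilon> j \<omega>, Y \<omega>)))"
    by (subst nn_integral_distr) auto
  also have "\<dots> = (\<integral>\<^sup>+x. (\<integral>\<^sup>+y. ennreal (f (a j * x + y)) \<partial>distr M borel Y) \<partial>distr M borel (\<epsilon> j))"
    unfolding ind[symmetric] by (subst Y.nn_integral_fst[symmetric]) auto
  also have "\<dots> = (\<integral>\<^sup>+\<omega>. (\<integral>\<^sup>+y. ennreal (f (a j * \<epsilon> j \<omega> + y)) \<partial>distr M borel Y) \<partial>M)"
    by (subst nn_integral_distr) auto
  also have "\<dots> = ((\<integral>\<^sup>+y. ennreal (f (a j * 1 + y)) \<partial>distr M borel Y) + (\<integral>\<^sup>+y. ennreal (f (a j * (-1) + y)) \<partial>distr M borel Y)) / 2"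
    by (rule nn_integral_rademacher) (use insert.prems in auto)
  also have "(\<integral>\<^sup>+y. ennreal (f (a j * 1 + y)) \<partial>distr M borel Y) = ennreal (sign_mean I a (\<lambda>y. f (y + a j)))"
    using IH[of "\<lambda>y. f (y + a j)"] insert.prems(4) by (subst nn_integral_distr) (auto simp: add.commute)
  also have "(\<integral>\<^sup>+y. ennreal (f (a j * (-1) + y)) \<partial>distr M borel Y) = ennreal (sign_mean I a (\<lambda>y. f (y - a j)))"
    using IH[of "\<lambda>y. f (y - a j)"] insert.prems(4) by (subst nn_integral_distr) (auto simp: add.commute)
  also have "(ennreal (sign_mean I a (\<lambda>y. f (y + a j))) + ennreal (sign_mean I a (\<lambda>y. f (y - a j)))) / 2
    = ennreal (sign_mean (insert j I) a f)"
  proof -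
    have "0 \<le> sign_mean I a (\<lambda>y. f (y + a j))" "0 \<le> sign_mean I a (\<lambda>y. f (y - a j))"
      unfolding sign_mean_def using insert.prems(4) by (auto intro!: divide_nonneg_nonneg sum_nonneg)
    then show ?thesis
      unfolding sign_mean_insert[OF insert.hyps]
      by (simp add: ennreal_divide_numeral[symmetric])
  qed
  finally show ?case .
qed

theorem corollary1:
  fixes M :: "'a measure" and N :: "'b measure"
    and \<epsilon> :: "nat \<Rightarrow> 'a \<Rightarrow> real" and G :: "'b \<Rightarrow> real"
    and n :: nat and a :: "nat \<Rightarrow> real" and p :: real
  assumes "prob_space M" and "prob_space N"
    and "prob_space.indep_vars M (\<lambda>_. borel) \<epsilon> {1..n}"
    and "\<And>i. i \<in> {1..n} \<Longrightarrow> rademacher M (\<epsilon> i)"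
    and "standard_gaussian N G"
    and "n \<ge> 1"
    and "(\<Sum>i=1..n. (a i)\<^sup>2) = 1"
    and "p \<ge> 4"
  shows "Lp_norm M p (\<lambda>\<omega>. \<Sum>i=1..n. a i * \<epsilon> i \<omega>) / Lp_norm N p G
           \<le> 1 - 1/6 * (\<Sum>i=1..n. (a i)^4)"
proof -
  interpret M: prob_space M by fact
  define b where "b = 1 - (\<Sum>i=1..n. (a i)^4) / 6"
  have b: "b > 0" using sum_fourth_le_one[OF _ assms(7)] by (simp add: b_def)
  let ?E = "sign_mean {1..n} a (\<lambda>s. \<bar>s\<bar> powr p)"
  have E: "0 \<le> ?E" unfolding sign_mean_def by (intro divide_nonneg_nonneg sum_nonneg) auto
  have [measurable]: "\<epsilon> i \<in> borel_measurable M" if "i \<in> {1..n}" for i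
    using assms(4)[OF that] by (simp add: rademacher_def)
  have "(\<integral>\<^sup>+\<omega>. ennreal (\<bar>\<Sum>i=1..n. a i * \<epsilon> i \<omega>\<bar> powr p) \<partial>M) = ennreal ?E"
    using M.nn_integral_rademacher_sum[OF _ assms(3,4), of "\<lambda>s. \<bar>s\<bar> powr p" a] by simp
  then have LM: "Lp_norm M p (\<lambda>\<omega>. \<Sum>i=1..n. a i * \<epsilon> i \<omega>) = ?E powr (1/p)"
    unfolding Lp_norm_def using E by (subst integral_eq_nn_integral) auto
  have LN: "Lp_norm N p G = gauss_abs_moment p powr (1/p)"
    unfolding Lp_norm_def gauss_abs_moment_def using assms(5)
    by (subst distributed_integral[symmetric]) (auto simp: standard_gaussian_def)
  \<comment> \<open>Positivity of the Gaussian moment follows from the bound itself, applied to a single sign.\<close>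
  have "sign_mean {0::nat} (\<lambda>_. 1) (\<lambda>s. \<bar>s\<bar> powr p) = 1"
    using sign_mean_insert[of "{}" "0::nat" "\<lambda>_. 1" "\<lambda>s. \<bar>s\<bar> powr p"] by simp
  then have "gauss_abs_moment p \<noteq> 0"
    using khinchine_boundD[OF khinchine_bound[OF assms(8)], of "{0}" "\<lambda>_. 1"] by auto
  then have pos: "0 < gauss_abs_moment p"
    using gauss_abs_moment_nonneg[of p] by simp
  have le: "?E \<le> b powr p * gauss_abs_moment p"
    using khinchine_boundD[OF khinchine_bound[OF assms(8)] _ assms(7)] by (simp add: b_def)
  have "?E powr (1/p) \<le> (b powr p * gauss_abs_moment p) powr (1/p)"
    using le E assms(8) by (intro powr_mono2) auto
  also have "\<dots> = b * gauss_abs_moment p powr (1/p)"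
    using b assms(8) pos by (simp add: powr_mult powr_powr)
  finally have "?E powr (1/p) / gauss_abs_moment p powr (1/p) \<le> b"
    using pos by (simp add: divide_le_eq)
  then show ?thesis unfolding LM LN by (simp add: b_def)
qed

end
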